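(* The $L^2$-Wasserstein space $(\mathcal{P}_2(\mathbb{R}^d),W_2)$ over the Euclidean space $\mathbb{R}^d$ has a cone structure, and is isometric to the direct product of $\mathbb{R}^d$ and a certain Polish space whose rank is zero.
   Context: $\mathcal{P}_2(\mathbb{R}^d)$ is the set of Borel probability measures on $\mathbb{R}^d$ with finite second moment, endowed with the distance $$W_2(\mu,\nu)=\Bigl(\inf_{\pi\in\Pi(\mu,\nu)}\int_{\mathbb{R}^d\times \mathbb{R}^d}|x-y|^2\,d\pi(x,y)\Bigr)^{1/2},$$ where $\Pi(\mu,\nu)$ is the set of Borel probability measures on $\mathbb{R}^d\times\mathbb{R}^d$ with marginals $\mu$ and $\nu$. A Polish space is a complete separable metric space. The direct product of metric spaces $(A,d_A)$ and $(B,d_B)$ carries the distance $\bigl(d_A(a,a')^2+d_B(b,b')^2\bigr)^{1/2}$ between $(a,b)$ and $(a',b')$. The cone over a metric space $(\Sigma,\angle)$ is the quotient $C(\Sigma)=\Sigma\times[0,\infty)/\sim$, which identifies all points $(\xi,0)$, $\xi\in\Sigma$, to one point called the vertex (and makes no other identification), with the distance $$d_C((\xi,s),(\eta,t))=\sqrt{s^2+t^2-2st\cos(\min\{\angle(\xi,\eta),\pi\})}.$$ A metric space has a cone structure if it is isometric to $C(\Sigma)$ for some metric space $\Sigma$. The rank of a metric space is the supremum (possibly $\infty$) of the integers $k\ge 0$ such that the Euclidean space $\mathbb{R}^k$ can be isometrically embedded into it (isometric embedding means distance-preserving map). *)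

theory Defs
  imports "HOL-Probability.Probability"
begin

text \<open>Metric spaces are given by a carrier set and a distance, as in the locale
  \<^locale>\<open>Metric_space\<close>; values of the distance outside the carrier are irrelevant.\<close>

definition isometric_embedding ::
    "'a set \<Rightarrow> ('a \<Rightarrow> 'a \<Rightarrow> real) \<Rightarrow> 'b set \<Rightarrow> ('b \<Rightarrow> 'b \<Rightarrow> real) \<Rightarrow> ('a \<Rightarrow> 'b) \<Rightarrow> bool" where
  "isometric_embedding M d N e f \<longleftrightarrow>
     f ` M \<subseteq> N \<and> (\<forall>x\<in>M. \<forall>y\<in>M. e (f x) (f y) = d x y)"

definition isometric ::
    "'a set \<Rightarrow> ('a \<Rightarrow> 'a \<Rightarrow> real) \<Rightarrow> 'b set \<Rightarrow> ('b \<Rightarrow> 'b \<Rightarrow> real) \<Rightarrow> bool" where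
  "isometric M d N e \<longleftrightarrow> (\<exists>f. bij_betw f M N \<and> isometric_embedding M d N e f)"

definition polish_metric_space :: "'a set \<Rightarrow> ('a \<Rightarrow> 'a \<Rightarrow> real) \<Rightarrow> bool" where
  "polish_metric_space M d \<longleftrightarrow>
     Metric_space M d \<and> Metric_space.mcomplete M d \<and>
     separable_space (Metric_space.mtopology M d)"

text \<open>The Euclidean space of dimension \<open>k\<close>, for \<open>k\<close> a natural number, is
  \<^term>\<open>topspace (Euclidean_space k)\<close>: sequences vanishing from index \<open>k\<close> on.\<close>

definition euclid_dist :: "nat \<Rightarrow> (nat \<Rightarrow> real) \<Rightarrow> (nat \<Rightarrow> real) \<Rightarrow> real" where
  "euclid_dist k x y = sqrt (\<Sum>i<k. (x i - y i)\<^sup>2)"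

definition metric_rank :: "'a set \<Rightarrow> ('a \<Rightarrow> 'a \<Rightarrow> real) \<Rightarrow> enat" where
  "metric_rank M d =
     Sup {enat k |k. \<exists>f. isometric_embedding (topspace (Euclidean_space k)) (euclid_dist k) M d f}"

definition cone_rel :: "'a set \<Rightarrow> (('a \<times> real) \<times> ('a \<times> real)) set" where
  "cone_rel \<Sigma> =
     {(p, q). p \<in> \<Sigma> \<times> {0..} \<and> q \<in> \<Sigma> \<times> {0..} \<and> (p = q \<or> snd p = 0 \<and> snd q = 0)}"

definition cone :: "'a set \<Rightarrow> ('a \<times> real) set set" where
  "cone \<Sigma> = (\<Sigma> \<times> {0..}) // cone_rel \<Sigma>"

definition cone_predist ::
    "('a \<Rightarrow> 'a \<Rightarrow> real) \<Rightarrow> 'a \<times> real \<Rightarrow> 'a \<times> real \<Rightarrow> real" where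
  "cone_predist ang = (\<lambda>(\<xi>, s) (\<eta>, t).
     sqrt (s\<^sup>2 + t\<^sup>2 - 2 * s * t * cos (min (ang \<xi> \<eta>) pi)))"

text \<open>The distance of two classes is the common value of \<^const>\<open>cone_predist\<close> on
  representatives; see \<open>cone_dist_class\<close> below.\<close>

definition cone_dist ::
    "('a \<Rightarrow> 'a \<Rightarrow> real) \<Rightarrow> ('a \<times> real) set \<Rightarrow> ('a \<times> real) set \<Rightarrow> real" where
  "cone_dist ang P Q = the_elem (\<Union>p\<in>P. \<Union>q\<in>Q. {cone_predist ang p q})"

text \<open>HOL cannot quantify over the type of the points of \<open>\<Sigma>\<close>. Taking \<open>\<Sigma>\<close> in the type of the
  points of \<open>M\<close> loses nothing: \<open>\<xi> \<mapsto> (\<xi>, 1)\<close> injects \<open>\<Sigma>\<close> into its cone, hence into any space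
  isometric to the cone, and the metric can be carried over.\<close>

definition has_cone_structure :: "'a set \<Rightarrow> ('a \<Rightarrow> 'a \<Rightarrow> real) \<Rightarrow> bool" where
  "has_cone_structure M d \<longleftrightarrow>
     (\<exists>(\<Sigma> :: 'a set) ang. Metric_space \<Sigma> ang \<and> isometric M d (cone \<Sigma>) (cone_dist ang))"

definition P2 :: "'a::euclidean_space measure set" where
  "P2 = {\<mu>. prob_space \<mu> \<and> sets \<mu> = sets borel \<and> integrable \<mu> (\<lambda>x. (norm x)\<^sup>2)}"

definition couplings ::
    "'a::euclidean_space measure \<Rightarrow> 'a measure \<Rightarrow> ('a \<times> 'a) measure set" where
  "couplings \<mu> \<nu> =
     {\<pi>. prob_space \<pi> \<and> sets \<pi> = sets borel \<and> distr \<pi> borel fst = \<mu> \<and> distr \<pi> borel snd = \<nu>}"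

text \<open>The transport cost is taken in \<^typ>\<open>ennreal\<close>; on \<^const>\<open>P2\<close> the infimum is finite (the
  product measure is a coupling of finite cost), so \<^const>\<open>enn2real\<close> does not truncate.\<close>

definition W2 :: "'a::euclidean_space measure \<Rightarrow> 'a measure \<Rightarrow> real" where
  "W2 \<mu> \<nu> =
     sqrt (enn2real (INF \<pi>\<in>couplings \<mu> \<nu>. \<integral>\<^sup>+ (x, y). ennreal ((norm (x - y))\<^sup>2) \<partial>\<pi>))"

lemma equiv_cone_rel: "equiv (\<Sigma> \<times> {0..}) (cone_rel \<Sigma>)"
  by (rule equivI) (auto simp: cone_rel_def refl_on_def sym_def trans_def)

lemma cone_dist_class:
  assumes "p \<in> \<Sigma> \<times> {0..}" "q \<in> \<Sigma> \<times> {0..}"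
  shows "cone_dist ang (cone_rel \<Sigma> `` {p}) (cone_rel \<Sigma> `` {q}) = cone_predist ang p q"
proof -
  have "cone_predist ang p' q' = cone_predist ang p q"
    if "p' \<in> cone_rel \<Sigma> `` {p}" "q' \<in> cone_rel \<Sigma> `` {q}" for p' q'
    using that by (auto simp: cone_rel_def cone_predist_def)
  moreover have "p \<in> cone_rel \<Sigma> `` {p}" "q \<in> cone_rel \<Sigma> `` {q}"
    using assms by (auto simp: cone_rel_def)
  ultimately have "(\<Union>p'\<in>cone_rel \<Sigma> `` {p}. \<Union>q'\<in>cone_rel \<Sigma> `` {q}. {cone_predist ang p' q'})
      = {cone_predist ang p q}"
    by blast
  then show ?thesis
    by (simp add: cone_dist_def)
qed

end

theory Submission
  imports Defs
begin

text \<open>Every coupling is approximated by one given by a kernel that depends on the first point only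
  through its cell in a fine countable partition. By the Ionescu-Tulcea theorem such kernels
  compose to chains \<open>X\<^sub>0, X\<^sub>1, \<dots>\<close> of random variables with prescribed laws and nearly optimal
  consecutive costs. This gives the triangle inequality, and for fast Cauchy sequences the chain
  converges almost surely to a variable whose law is the limit.

  The law of \<open>s X\<close>, for \<open>X\<close> with second moment one, is the point \<open>(\<mu>, s)\<close> of the cone: expanding the
  square shows that the distances between dilates obey the law of cosines with
  \<open>cos \<angle>(\<mu>, \<nu>) = 1 - W\<^sub>2(\<mu>, \<nu>)\<^sup>2 / 2\<close>, and the triangle inequality for \<open>\<angle>\<close> follows from that of \<open>W\<^sub>2\<close>.
  Expanding the square for translates splits off the mean, leaving the space of centered measures.
  There the product coupling gives \<open>W\<^sub>2(\<mu>, \<nu>)\<^sup>2 \<le> W\<^sub>2(\<mu>, \<delta>\<^sub>0)\<^sup>2 + W\<^sub>2(\<nu>, \<delta>\<^sub>0)\<^sup>2\<close>, so the points at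
  parameters \<open>\<plusminus>t\<close> of a line would satisfy \<open>4 t\<^sup>2 \<le> 2 (c + t)\<^sup>2\<close> for all \<open>t > 0\<close>.\<close>

section \<open>Couplings and their cost\<close>

text \<open>Couplings are only ever nearly optimal: a strict bound \<open>W2 \<mu> \<nu> < c\<close>
  supplies a coupling, and its slack pays for the diameter of the cells. There are countably many
  cells, so a kernel that factors through them is measurable for free. The price is that
  \<open>W2 \<mu> \<nu> = 0\<close> does not directly hand over a coupling on the diagonal, so
  equality of the measures has to be tested on closed sets.

  Expanding a square helps for a single reason. If the squared distance of \<open>f x\<close> and
  \<open>g y\<close> is a nonnegative multiple of that of \<open>x\<close> and \<open>y\<close>,
  plus a function of \<open>x\<close>, plus a function of \<open>y\<close>, then the last two terms
  integrate to the same value for every coupling, and the infimum passes through. Translations and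
  dilations both have this form, and invertibility turns the resulting bounds into
  equalities.\<close>

lemma measurable_borel_fst [measurable]:
  "(fst :: 'a::second_countable_topology \<times> 'b::second_countable_topology \<Rightarrow> 'a) \<in> borel \<rightarrow>\<^sub>M borel"
  by (simp add: borel_prod[symmetric])

lemma measurable_borel_snd [measurable]:
  "(snd :: 'a::second_countable_topology \<times> 'b::second_countable_topology \<Rightarrow> 'b) \<in> borel \<rightarrow>\<^sub>M borel"
  by (simp add: borel_prod[symmetric])

text \<open>Written with projections so that \<open>nn_integral_distr\<close> applies directly, and
  valued in \<open>ennreal\<close> so that no integrability has to be known beforehand.\<close>

definition cost :: "('a::euclidean_space \<times> 'a) measure \<Rightarrow> ennreal" where
  "cost \<pi> = (\<integral>\<^sup>+ p. ennreal ((norm (fst p - snd p))\<^sup>2) \<partial>\<pi>)"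

lemma W2_eq_cost: "W2 \<mu> \<nu> = sqrt (enn2real (INF \<pi>\<in>couplings \<mu> \<nu>. cost \<pi>))"
  by (simp add: W2_def cost_def case_prod_beta')

lemma couplingsD:
  assumes "\<pi> \<in> couplings \<mu> \<nu>"
  shows "prob_space \<pi>" "sets \<pi> = sets borel" "distr \<pi> borel fst = \<mu>" "distr \<pi> borel snd = \<nu>"
  using assms by (auto simp: couplings_def)

lemma P2D:
  assumes "\<mu> \<in> P2"
  shows "prob_space \<mu>" "sets \<mu> = sets borel" "integrable \<mu> (\<lambda>x. (norm x)\<^sup>2)"
  using assms by (auto simp: P2_def)

lemma P2_nn_integral_finite:
  assumes "\<mu> \<in> P2"
  shows "(\<integral>\<^sup>+ x. ennreal ((norm x)\<^sup>2) \<partial>\<mu>) < \<infinity>"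
  using P2D(3)[OF assms] by (simp add: integrable_iff_bounded)

lemma P2I:
  assumes "prob_space \<mu>" "sets \<mu> = sets borel" "(\<integral>\<^sup>+ x. ennreal ((norm x)\<^sup>2) \<partial>\<mu>) < \<infinity>"
  shows "\<mu> \<in> P2"
proof -
  have [measurable_cong]: "sets \<mu> = sets borel"
    by (fact assms)
  show ?thesis
    using assms by (auto simp: P2_def integrable_iff_bounded)
qed

lemma coupling_distr:
  fixes X Y :: "'w \<Rightarrow> 'a::euclidean_space"
  assumes "prob_space \<Omega>" and [measurable]: "X \<in> borel_measurable \<Omega>" "Y \<in> borel_measurable \<Omega>"
  shows "distr \<Omega> borel (\<lambda>w. (X w, Y w)) \<in> couplings (distr \<Omega> borel X) (distr \<Omega> borel Y)"
proof -
  interpret prob_space \<Omega> by fact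
  have [measurable]: "(\<lambda>w. (X w, Y w)) \<in> \<Omega> \<rightarrow>\<^sub>M borel"
    by simp
  show ?thesis
    by (auto simp: couplings_def distr_distr comp_def intro!: prob_space_distr)
qed

lemma W2_le_cost:
  assumes "\<pi> \<in> couplings \<mu> \<nu>" "cost \<pi> \<le> ennreal (c\<^sup>2)" "0 \<le> c"
  shows "W2 \<mu> \<nu> \<le> c"
proof -
  have "(INF \<pi>\<in>couplings \<mu> \<nu>. cost \<pi>) \<le> ennreal (c\<^sup>2)"
    using assms(1,2) by (meson INF_lower2)
  then have "enn2real (INF \<pi>\<in>couplings \<mu> \<nu>. cost \<pi>) \<le> c\<^sup>2"
    by (intro enn2real_leI) simp_all
  then show ?thesis
    using assms(3) by (simp add: W2_eq_cost real_le_lsqrt)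
qed

text \<open>The joint law of \<open>X\<close> and \<open>Y\<close> is a coupling. In this form a
  bound on \<open>W2\<close> can be read off from any probability space that carries both
  variables.\<close>

lemma W2_le_of_random_variables:
  fixes X Y :: "'w \<Rightarrow> 'a::euclidean_space"
  assumes "prob_space \<Omega>" and [measurable]: "X \<in> borel_measurable \<Omega>" "Y \<in> borel_measurable \<Omega>"
    and "distr \<Omega> borel X = \<mu>" "distr \<Omega> borel Y = \<nu>"
    and "(\<integral>\<^sup>+ w. ennreal ((norm (X w - Y w))\<^sup>2) \<partial>\<Omega>) \<le> ennreal (c\<^sup>2)" "0 \<le> c"
  shows "W2 \<mu> \<nu> \<le> c"
proof (rule W2_le_cost)
  show "distr \<Omega> borel (\<lambda>w. (X w, Y w)) \<in> couplings \<mu> \<nu>"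
    using coupling_distr[OF assms(1-3)] assms(4,5) by simp
  have [measurable]: "(\<lambda>w. (X w, Y w)) \<in> \<Omega> \<rightarrow>\<^sub>M borel"
    by simp
  show "cost (distr \<Omega> borel (\<lambda>w. (X w, Y w))) \<le> ennreal (c\<^sup>2)"
    using assms(6) by (simp add: cost_def nn_integral_distr)
qed fact

text \<open>From (u + v)^2 \<le> 2 u^2 + 2 v^2 and the marginals. Finiteness matters because
  \<open>enn2real\<close> would turn an infinite infimum into distance 0.\<close>

lemma cost_finite:
  fixes \<mu> \<nu> :: "'a::euclidean_space measure"
  assumes "\<mu> \<in> P2" "\<nu> \<in> P2" and \<pi>: "\<pi> \<in> couplings \<mu> \<nu>"
  shows "cost \<pi> < \<infinity>"
proof -
  note [measurable_cong] = couplingsD(2)[OF \<pi>]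
  have le: "(norm (x - y))\<^sup>2 \<le> 2 * (norm x)\<^sup>2 + 2 * (norm y)\<^sup>2" for x y :: 'a
  proof -
    have "(norm (x - y))\<^sup>2 \<le> (norm x + norm y)\<^sup>2"
      by (intro power_mono norm_triangle_ineq4) simp
    also have "\<dots> \<le> 2 * (norm x)\<^sup>2 + 2 * (norm y)\<^sup>2"
      using sum_squares_bound[of "norm x" "norm y"] by (simp add: power2_sum)
    finally show ?thesis .
  qed
  have "cost \<pi> \<le> (\<integral>\<^sup>+ p. 2 * ennreal ((norm (fst p))\<^sup>2) + 2 * ennreal ((norm (snd p))\<^sup>2) \<partial>\<pi>)"
    unfolding cost_def
  proof (rule nn_integral_mono)
    fix p :: "'a \<times> 'a"
    have "ennreal ((norm (fst p - snd p))\<^sup>2) \<le> ennreal (2 * (norm (fst p))\<^sup>2 + 2 * (norm (snd p))\<^sup>2)"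
      by (intro ennreal_leI le)
    then show "ennreal ((norm (fst p - snd p))\<^sup>2) \<le> 2 * ennreal ((norm (fst p))\<^sup>2) + 2 * ennreal ((norm (snd p))\<^sup>2)"
      by (simp add: ennreal_plus ennreal_mult)
  qed
  also have "\<dots> = 2 * (\<integral>\<^sup>+ p. ennreal ((norm (fst p))\<^sup>2) \<partial>\<pi>) + 2 * (\<integral>\<^sup>+ p. ennreal ((norm (snd p))\<^sup>2) \<partial>\<pi>)"
    by (simp add: nn_integral_add nn_integral_cmult)
  also have "(\<integral>\<^sup>+ p. ennreal ((norm (fst p))\<^sup>2) \<partial>\<pi>) = (\<integral>\<^sup>+ x. ennreal ((norm x)\<^sup>2) \<partial>\<mu>)"
    by (subst couplingsD(3)[OF \<pi>, symmetric], subst nn_integral_distr) auto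
  also have "(\<integral>\<^sup>+ p. ennreal ((norm (snd p))\<^sup>2) \<partial>\<pi>) = (\<integral>\<^sup>+ x. ennreal ((norm x)\<^sup>2) \<partial>\<nu>)"
    by (subst couplingsD(4)[OF \<pi>, symmetric], subst nn_integral_distr) auto
  also have "2 * (\<integral>\<^sup>+ x. ennreal ((norm x)\<^sup>2) \<partial>\<mu>) + 2 * (\<integral>\<^sup>+ x. ennreal ((norm x)\<^sup>2) \<partial>\<nu>) < \<infinity>"
    using P2_nn_integral_finite[OF assms(1)] P2_nn_integral_finite[OF assms(2)]
    by (simp add: ennreal_mult_less_top)
  finally show ?thesis .
qed

lemma pair_measure_coupling:
  fixes \<mu> \<nu> :: "'a::euclidean_space measure"
  assumes "prob_space \<mu>" "prob_space \<nu>" "sets \<mu> = sets borel" "sets \<nu> = sets borel"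
  shows "\<mu> \<Otimes>\<^sub>M \<nu> \<in> couplings \<mu> \<nu>"
proof -
  interpret \<mu>: prob_space \<mu> by fact
  interpret \<nu>: prob_space \<nu> by fact
  interpret pair_prob_space \<mu> \<nu> ..
  note [measurable_cong] = assms(3,4)
  have "sets (\<mu> \<Otimes>\<^sub>M \<nu>) = sets borel"
    using assms(3,4) by (metis borel_prod sets_pair_measure_cong)
  moreover have "distr (\<mu> \<Otimes>\<^sub>M \<nu>) borel fst = distr (\<mu> \<Otimes>\<^sub>M \<nu>) \<mu> fst"
    "distr (\<mu> \<Otimes>\<^sub>M \<nu>) borel snd = distr (\<mu> \<Otimes>\<^sub>M \<nu>) \<nu> snd"
    using assms(3,4) by (auto intro!: distr_cong)
  moreover have "distr (\<mu> \<Otimes>\<^sub>M \<nu>) \<mu> fst = \<mu>"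
    by (rule \<nu>.distr_pair_fst)
  moreover have "distr (\<mu> \<Otimes>\<^sub>M \<nu>) \<nu> snd = \<nu>"
    by (subst distr_pair_swap, subst distr_distr)
       (auto simp: comp_def case_prod_beta \<mu>.distr_pair_fst)
  ultimately show ?thesis
    unfolding couplings_def using P.prob_space_axioms by auto
qed

text \<open>The product coupling has finite cost, so the infimum is finite and a bound on its real
  value is a bound on the infimum itself. Strictness then yields an element below the bound.\<close>

lemma W2_lessD:
  assumes "\<mu> \<in> P2" "\<nu> \<in> P2" "W2 \<mu> \<nu> < c"
  obtains \<pi> where "\<pi> \<in> couplings \<mu> \<nu>" "cost \<pi> < ennreal (c\<^sup>2)"
proof -
  let ?I = "INF \<pi>\<in>couplings \<mu> \<nu>. cost \<pi>"
  have p: "\<mu> \<Otimes>\<^sub>M \<nu> \<in> couplings \<mu> \<nu>"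
    using assms by (intro pair_measure_coupling) (auto dest: P2D)
  have fin: "?I < \<infinity>"
    using INF_lower[OF p, of cost] cost_finite[OF assms(1,2) p] by (rule le_less_trans)
  have "0 \<le> sqrt (enn2real ?I)"
    by simp
  then have "0 \<le> c"
    using assms(3) unfolding W2_eq_cost by linarith
  then have "enn2real ?I < c\<^sup>2"
    using assms(3) unfolding W2_eq_cost
    by (metis \<open>0 \<le> sqrt _\<close> enn2real_nonneg power_strict_mono real_sqrt_pow2 zero_less_numeral)
  then have "?I < ennreal (c\<^sup>2)"
    using fin by (metis enn2real_nonneg ennreal_enn2real ennreal_less_iff infinity_ennreal_def)
  then show ?thesis
    using that by (auto simp: INF_less_iff)
qed

lemma W2_nonneg: "0 \<le> W2 \<mu> \<nu>"
  by (simp add: W2_eq_cost)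

lemma W2_commute: "W2 \<mu> \<nu> = W2 \<nu> (\<mu> :: 'a::euclidean_space measure)"
proof -
  have swap: "\<exists>\<pi>'\<in>couplings \<nu> \<mu>. cost \<pi>' = cost \<pi>" if \<pi>: "\<pi> \<in> couplings \<mu> \<nu>"
    for \<pi> and \<mu> \<nu> :: "'a measure"
  proof -
    note [measurable_cong] = couplingsD(2)[OF \<pi>]
    let ?\<pi> = "distr \<pi> borel (\<lambda>p. (snd p, fst p))"
    have "?\<pi> \<in> couplings \<nu> \<mu>"
      using coupling_distr[of \<pi> snd fst] couplingsD[OF \<pi>] by simp
    moreover have "cost ?\<pi> = cost \<pi>"
      by (auto simp: cost_def nn_integral_distr norm_minus_commute)
    ultimately show ?thesis ..
  qed
  have "cost ` couplings \<mu> \<nu> \<subseteq> cost ` couplings \<nu> \<mu>" for \<mu> \<nu> :: "'a measure"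
  proof
    fix c assume "c \<in> cost ` couplings \<mu> \<nu>"
    then obtain \<pi> where "\<pi> \<in> couplings \<mu> \<nu>" "c = cost \<pi>"
      by blast
    with swap show "c \<in> cost ` couplings \<nu> \<mu>"
      by (metis imageI)
  qed
  from this[of \<mu> \<nu>] this[of \<nu> \<mu>] have "cost ` couplings \<mu> \<nu> = cost ` couplings \<nu> \<mu>"
    by (rule subset_antisym)
  then show ?thesis
    by (simp add: W2_eq_cost)
qed

section \<open>The Minkowski inequality for square integrals\<close>

lemma square_add_weighted_le:
  fixes u v a b :: real
  assumes "0 < a" "0 < b"
  shows "(u + v)\<^sup>2 \<le> (1 + b / a) * u\<^sup>2 + (1 + a / b) * v\<^sup>2"
proof -
  have "0 \<le> (b * u - a * v)\<^sup>2 / (a * b)"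
    using assms by simp
  also have "\<dots> = (1 + b / a) * u\<^sup>2 + (1 + a / b) * v\<^sup>2 - (u + v)\<^sup>2"
    using assms by (simp add: field_simps power2_eq_square)
  finally show ?thesis by simp
qed

text \<open>The weights in \<open>square_add_weighted_le\<close> are tuned to the ratio a : b, where
  that inequality is an equality; hence the sharp constant. Positive upper bounds \<open>a\<close>,
  \<open>b\<close> instead of the norms themselves avoid dividing by a norm that vanishes.\<close>

lemma nn_integral_minkowski:
  assumes [measurable]: "f \<in> borel_measurable M" "g \<in> borel_measurable M"
    and f: "(\<integral>\<^sup>+ x. ennreal ((f x)\<^sup>2) \<partial>M) \<le> ennreal (a\<^sup>2)"
    and g: "(\<integral>\<^sup>+ x. ennreal ((g x)\<^sup>2) \<partial>M) \<le> ennreal (b\<^sup>2)"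
    and ab: "0 < a" "0 < b"
  shows "(\<integral>\<^sup>+ x. ennreal ((f x + g x)\<^sup>2) \<partial>M) \<le> ennreal ((a + b)\<^sup>2)"
proof -
  have "(\<integral>\<^sup>+ x. ennreal ((f x + g x)\<^sup>2) \<partial>M)
      \<le> (\<integral>\<^sup>+ x. ennreal (1 + b / a) * ennreal ((f x)\<^sup>2) + ennreal (1 + a / b) * ennreal ((g x)\<^sup>2) \<partial>M)"
  proof (rule nn_integral_mono)
    fix x
    have "ennreal ((f x + g x)\<^sup>2) \<le> ennreal ((1 + b / a) * (f x)\<^sup>2 + (1 + a / b) * (g x)\<^sup>2)"
      by (intro ennreal_leI square_add_weighted_le ab)
    then show "ennreal ((f x + g x)\<^sup>2)
        \<le> ennreal (1 + b / a) * ennreal ((f x)\<^sup>2) + ennreal (1 + a / b) * ennreal ((g x)\<^sup>2)"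
      using ab by (simp add: ennreal_plus ennreal_mult del: ennreal_1)
  qed
  also have "\<dots> = ennreal (1 + b / a) * (\<integral>\<^sup>+ x. ennreal ((f x)\<^sup>2) \<partial>M)
      + ennreal (1 + a / b) * (\<integral>\<^sup>+ x. ennreal ((g x)\<^sup>2) \<partial>M)"
    by (simp add: nn_integral_add nn_integral_cmult)
  also have "\<dots> \<le> ennreal (1 + b / a) * ennreal (a\<^sup>2) + ennreal (1 + a / b) * ennreal (b\<^sup>2)"
    by (intro add_mono mult_left_mono f g) auto
  also have "\<dots> = ennreal ((1 + b / a) * a\<^sup>2 + (1 + a / b) * b\<^sup>2)"
    using ab by (simp add: ennreal_plus ennreal_mult del: ennreal_1)
  also have "(1 + b / a) * a\<^sup>2 + (1 + a / b) * b\<^sup>2 = (a + b)\<^sup>2"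
    using ab by (simp add: field_simps power2_eq_square)
  finally show ?thesis .
qed

lemma nn_integral_minkowski_dist:
  fixes X Y Z :: "'w \<Rightarrow> 'a::euclidean_space"
  assumes [measurable]: "X \<in> borel_measurable M" "Y \<in> borel_measurable M" "Z \<in> borel_measurable M"
    and XY: "(\<integral>\<^sup>+ w. ennreal ((norm (X w - Y w))\<^sup>2) \<partial>M) \<le> ennreal (a\<^sup>2)"
    and YZ: "(\<integral>\<^sup>+ w. ennreal ((norm (Y w - Z w))\<^sup>2) \<partial>M) \<le> ennreal (b\<^sup>2)"
    and ab: "0 < a" "0 < b"
  shows "(\<integral>\<^sup>+ w. ennreal ((norm (X w - Z w))\<^sup>2) \<partial>M) \<le> ennreal ((a + b)\<^sup>2)"
proof -
  have "(\<integral>\<^sup>+ w. ennreal ((norm (X w - Z w))\<^sup>2) \<partial>M)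
      \<le> (\<integral>\<^sup>+ w. ennreal ((norm (X w - Y w) + norm (Y w - Z w))\<^sup>2) \<partial>M)"
    by (intro nn_integral_mono ennreal_leI power_mono)
       (auto intro: norm_diff_triangle_ineq order_trans[OF _ norm_triangle_ineq])
  also have "\<dots> \<le> ennreal ((a + b)\<^sup>2)"
    by (intro nn_integral_minkowski XY YZ ab) auto
  finally show ?thesis .
qed

section \<open>Approximate disintegration and gluing of couplings\<close>

text \<open>The cell of \<open>x\<close> is the least index of a point of a countable dense set at
  distance below \<epsilon>/2. Two points of one cell share this centre.\<close>

lemma ex_small_cells:
  fixes \<epsilon> :: real
  assumes "0 < \<epsilon>"
  obtains q :: "'a::euclidean_space \<Rightarrow> nat" where
    "q \<in> borel \<rightarrow>\<^sub>M count_space UNIV" "\<And>x y. q x = q y \<Longrightarrow> norm (x - y) \<le> \<epsilon>"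
proof -
  obtain D :: "'a set" where D: "countable D" "\<And>X. open X \<Longrightarrow> X \<noteq> {} \<Longrightarrow> \<exists>d\<in>D. d \<in> X"
    using countable_dense_setE by blast
  define d where "d = from_nat_into D"
  define q where "q x = (LEAST n. dist x (d n) < \<epsilon> / 2)" for x
  have q: "dist x (d (q x)) < \<epsilon> / 2" for x
  proof -
    obtain z where "z \<in> D" "z \<in> ball x (\<epsilon> / 2)"
      using D(2)[of "ball x (\<epsilon> / 2)"] assms by auto
    then have "dist x (d (to_nat_on D z)) < \<epsilon> / 2"
      by (simp add: d_def D(1))
    then show ?thesis
      unfolding q_def by (rule LeastI)
  qed
  show ?thesis
  proof
    show "q \<in> borel \<rightarrow>\<^sub>M count_space UNIV"
      unfolding q_def by measurable
    show "norm (x - y) \<le> \<epsilon>" if "q x = q y" for x y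
      using dist_triangle2[of x y "d (q x)"] q[of x] q[of y] that by (simp add: dist_norm)
  qed
qed

text \<open>Conditioning on a null cell is meaningless; the default \<open>M\<close> keeps the value
  a probability measure for every index.\<close>

definition cond_measure :: "'w measure \<Rightarrow> ('w \<Rightarrow> nat) \<Rightarrow> nat \<Rightarrow> 'w measure" where
  "cond_measure M q i = (if emeasure M {w\<in>space M. q w = i} = 0 then M
     else uniform_measure M {w\<in>space M. q w = i})"

lemma sets_cond_measure [simp, measurable_cong]: "sets (cond_measure M q i) = sets M"
  by (simp add: cond_measure_def)

context
  fixes M :: "'w measure" and q :: "'w \<Rightarrow> nat"
  assumes M: "prob_space M" and q [measurable]: "q \<in> M \<rightarrow>\<^sub>M count_space UNIV"
begin

interpretation prob_space M by (fact M)

lemma prob_space_cond_measure: "prob_space (cond_measure M q i)"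
  by (auto simp: cond_measure_def prob_space_axioms intro!: prob_space_uniform_measure)

text \<open>There are countably many cells, so the null ones together form a null set.\<close>

lemma AE_cell_nonnull: "AE w in M. emeasure M {v\<in>space M. q v = q w} \<noteq> 0"
proof -
  have "AE w in M. \<forall>i. emeasure M {v\<in>space M. q v = i} = 0 \<longrightarrow> w \<notin> {v\<in>space M. q v = i}"
    unfolding AE_all_countable
  proof
    fix i
    show "AE w in M. emeasure M {v\<in>space M. q v = i} = 0 \<longrightarrow> w \<notin> {v\<in>space M. q v = i}"
    proof (cases "emeasure M {v\<in>space M. q v = i} = 0")
      case True
      then have "{v\<in>space M. q v = i} \<in> null_sets M"
        by (intro null_setsI) auto
      then show ?thesis
        by (rule AE_mp[OF AE_not_in]) auto
    qed auto
  qed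
  then show ?thesis
    using AE_space by eventually_elim auto
qed

lemma AE_cond_measure:
  assumes "emeasure M {v\<in>space M. q v = i} \<noteq> 0"
  shows "AE w in cond_measure M q i. q w = i"
proof -
  have "AE w in uniform_measure M {v\<in>space M. q v = i}. q w = i"
    by (intro AE_uniform_measureI AE_I2) auto
  then show ?thesis
    unfolding cond_measure_def by (simp only: assms if_False)
qed

text \<open>The law of total expectation. Cell \<open>i\<close> contributes
  \<open>F i * emeasure M (A i)\<close>, which is the integral of \<open>G\<close> over the cell; on
  a null cell both sides vanish whatever the conditional measure is.\<close>

lemma nn_integral_cond_measure:
  assumes G [measurable]: "G \<in> borel_measurable M"
  shows "(\<integral>\<^sup>+ w. (\<integral>\<^sup>+ v. G v \<partial>cond_measure M q (q w)) \<partial>M) = (\<integral>\<^sup>+ w. G w \<partial>M)"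
proof -
  define A where "A i = {w\<in>space M. q w = i}" for i
  have A [measurable]: "A i \<in> sets M" for i
    by (simp add: A_def)
  have disj: "disjoint_family A"
    by (auto simp: A_def disjoint_family_on_def)
  define F where "F i = (\<integral>\<^sup>+ v. G v \<partial>cond_measure M q i)" for i
  have F: "F i * emeasure M (A i) = (\<integral>\<^sup>+ w. G w * indicator (A i) w \<partial>M)" for i
  proof (cases "emeasure M (A i) = 0")
    case True
    then have "AE w in M. w \<notin> A i"
      using A by (intro AE_not_in) (auto simp: null_sets_def)
    then have "(\<integral>\<^sup>+ w. G w * indicator (A i) w \<partial>M) = (\<integral>\<^sup>+ w. 0 \<partial>M)"
      by (intro nn_integral_cong_AE) auto
    then show ?thesis
      using True by simp
  next
    case False
    then have "F i = (\<integral>\<^sup>+ w. G w * indicator (A i) w \<partial>M) / emeasure M (A i)"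
      unfolding F_def cond_measure_def A_def[symmetric]
      by (simp add: nn_integral_uniform_measure)
    then show ?thesis
      using False by (simp add: ennreal_divide_times less_top[symmetric])
  qed
  have "(\<integral>\<^sup>+ w. F (q w) \<partial>M) = (\<integral>\<^sup>+ w. (\<Sum>i. F i * indicator (A i) w) \<partial>M)"
  proof (rule nn_integral_cong)
    fix w assume "w \<in> space M"
    then show "F (q w) = (\<Sum>i. F i * indicator (A i) w)"
      by (subst suminf_cmult_indicator[OF disj, of w "q w"]) (auto simp: A_def)
  qed
  also have "\<dots> = (\<Sum>i. F i * emeasure M (A i))"
    by (simp add: nn_integral_suminf nn_integral_cmult)
  also have "\<dots> = (\<integral>\<^sup>+ w. (\<Sum>i. G w * indicator (A i) w) \<partial>M)"
  proof (subst nn_integral_suminf)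
    show "(\<Sum>i. F i * emeasure M (A i)) = (\<Sum>i. \<integral>\<^sup>+ w. G w * indicator (A i) w \<partial>M)"
      by (simp only: F)
  qed measurable
  also have "\<dots> = (\<integral>\<^sup>+ w. G w \<partial>M)"
  proof (rule nn_integral_cong)
    fix w assume "w \<in> space M"
    then show "(\<Sum>i. G w * indicator (A i) w) = G w"
      by (subst suminf_cmult_indicator[OF disj, of w "q w" "\<lambda>_. G w"]) (auto simp: A_def)
  qed
  finally show ?thesis
    unfolding F_def .
qed

end

text \<open>A substitute for disintegration: conditioning a nearly optimal coupling on the cell of the
  first point, instead of on the point itself, gives a kernel and costs at most the cell diameter.\<close>

lemma W2_less_kernel:
  fixes \<mu> \<nu> :: "'a::euclidean_space measure"
  assumes "\<mu> \<in> P2" "\<nu> \<in> P2" "W2 \<mu> \<nu> < c"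
  obtains K where "K \<in> borel \<rightarrow>\<^sub>M subprob_algebra borel" "\<And>x. prob_space (K x)"
    "\<And>h. h \<in> borel_measurable borel \<Longrightarrow> (\<integral>\<^sup>+ x. (\<integral>\<^sup>+ y. h y \<partial>K x) \<partial>\<mu>) = (\<integral>\<^sup>+ y. h y \<partial>\<nu>)"
    "(\<integral>\<^sup>+ x. (\<integral>\<^sup>+ y. ennreal ((norm (x - y))\<^sup>2) \<partial>K x) \<partial>\<mu>) \<le> ennreal (c\<^sup>2)"
proof -
  \<comment> \<open>The budget \<open>c\<close> is split: the coupling stays below \<open>a\<close>,
    and the remainder \<epsilon> = c - a > 0 is spent on the cell diameter.\<close>
  define a where "a = (W2 \<mu> \<nu> + c) / 2"
  define \<epsilon> where "\<epsilon> = c - a"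
  have a: "W2 \<mu> \<nu> < a" "0 < a" "0 < \<epsilon>" "\<epsilon> + a = c"
    using assms(3) W2_nonneg[of \<mu> \<nu>] by (auto simp: a_def \<epsilon>_def field_simps)
  obtain \<pi> where \<pi>: "\<pi> \<in> couplings \<mu> \<nu>" "cost \<pi> < ennreal (a\<^sup>2)"
    using W2_lessD[OF assms(1,2) a(1)] .
  obtain q :: "'a \<Rightarrow> nat" where q [measurable]: "q \<in> borel \<rightarrow>\<^sub>M count_space UNIV"
    and cell: "\<And>x y. q x = q y \<Longrightarrow> norm (x - y) \<le> \<epsilon>"
    using ex_small_cells[OF a(3)] by metis
  note \<pi>D = couplingsD[OF \<pi>(1)]
  note [measurable_cong] = \<pi>D(2)
  define Q where "Q p = q (fst p)" for p :: "'a \<times> 'a"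
  have Q [measurable]: "Q \<in> \<pi> \<rightarrow>\<^sub>M count_space UNIV"
    unfolding Q_def by measurable
  define U where "U = cond_measure \<pi> Q"
  have U [measurable_cong]: "sets (U i) = sets borel" for i
    by (simp add: U_def \<pi>D)
  have U_prob: "prob_space (U i)" for i
    unfolding U_def by (rule prob_space_cond_measure[OF \<pi>D(1) Q])
  define J where "J i = distr (U i) borel snd" for i
  have J_prob: "prob_space (J i)" for i
    unfolding J_def by (intro prob_space.prob_space_distr U_prob) measurable
  have to_\<pi>: "(\<integral>\<^sup>+ x. F (q x) \<partial>\<mu>) = (\<integral>\<^sup>+ w. F (Q w) \<partial>\<pi>)" for F :: "nat \<Rightarrow> ennreal"
    by (subst \<pi>D(3)[symmetric], subst nn_integral_distr) (auto simp: Q_def)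
  show ?thesis
  proof
    show "(\<lambda>x. J (q x)) \<in> borel \<rightarrow>\<^sub>M subprob_algebra borel"
    proof (rule measurable_compose[OF q])
      show "J \<in> count_space UNIV \<rightarrow>\<^sub>M subprob_algebra borel"
        using J_prob by (auto simp: space_subprob_algebra J_def intro!: prob_space_imp_subprob_space)
    qed
    show "prob_space (J (q x))" for x
      by (rule J_prob)
    show "(\<integral>\<^sup>+ x. (\<integral>\<^sup>+ y. h y \<partial>J (q x)) \<partial>\<mu>) = (\<integral>\<^sup>+ y. h y \<partial>\<nu>)"
      if [measurable]: "h \<in> borel_measurable borel" for h
    proof -
      have "(\<integral>\<^sup>+ x. (\<integral>\<^sup>+ y. h y \<partial>J (q x)) \<partial>\<mu>) = (\<integral>\<^sup>+ w. (\<integral>\<^sup>+ p. h (snd p) \<partial>U (Q w)) \<partial>\<pi>)"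
        by (subst to_\<pi>) (simp add: J_def nn_integral_distr)
      also have "\<dots> = (\<integral>\<^sup>+ p. h (snd p) \<partial>\<pi>)"
        unfolding U_def by (rule nn_integral_cond_measure[OF \<pi>D(1) Q]) measurable
      also have "\<dots> = (\<integral>\<^sup>+ y. h y \<partial>\<nu>)"
        by (subst \<pi>D(4)[symmetric], subst nn_integral_distr) auto
      finally show ?thesis .
    qed
    \<comment> \<open>On a null cell \<open>U\<close> is the whole coupling, whose first coordinate
      need not lie near \<open>x\<close>; such \<open>x\<close> are negligible.\<close>
    have null: "AE x in \<mu>. emeasure \<pi> {v\<in>space \<pi>. Q v = q x} \<noteq> 0"
      using AE_cell_nonnull[OF \<pi>D(1) Q]
      by (subst \<pi>D(3)[symmetric], subst AE_distr_iff) (auto simp: Q_def)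
    have "(\<integral>\<^sup>+ x. (\<integral>\<^sup>+ y. ennreal ((norm (x - y))\<^sup>2) \<partial>J (q x)) \<partial>\<mu>)
        \<le> (\<integral>\<^sup>+ x. (\<integral>\<^sup>+ p. ennreal ((\<epsilon> + norm (fst p - snd p))\<^sup>2) \<partial>U (q x)) \<partial>\<mu>)"
    proof (rule nn_integral_mono_AE, use null in eventually_elim)
      fix x assume nn: "emeasure \<pi> {v\<in>space \<pi>. Q v = q x} \<noteq> 0"
      have "(\<integral>\<^sup>+ y. ennreal ((norm (x - y))\<^sup>2) \<partial>J (q x)) = (\<integral>\<^sup>+ p. ennreal ((norm (x - snd p))\<^sup>2) \<partial>U (q x))"
        by (simp add: J_def nn_integral_distr)
      also have "\<dots> \<le> (\<integral>\<^sup>+ p. ennreal ((\<epsilon> + norm (fst p - snd p))\<^sup>2) \<partial>U (q x))"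
      proof (rule nn_integral_mono_AE)
        have "AE p in U (q x). Q p = q x"
          unfolding U_def by (rule AE_cond_measure[OF \<pi>D(1) Q nn])
        then show "AE p in U (q x). ennreal ((norm (x - snd p))\<^sup>2) \<le> ennreal ((\<epsilon> + norm (fst p - snd p))\<^sup>2)"
        proof eventually_elim
          fix p assume "Q p = q x"
          then have "norm (x - fst p) \<le> \<epsilon>"
            by (intro cell) (simp add: Q_def)
          then have "norm (x - snd p) \<le> \<epsilon> + norm (fst p - snd p)"
            using norm_triangle_ineq[of "x - fst p" "fst p - snd p"] by simp
          then show "ennreal ((norm (x - snd p))\<^sup>2) \<le> ennreal ((\<epsilon> + norm (fst p - snd p))\<^sup>2)"
            by (intro ennreal_leI power_mono) auto
        qed
      qed
      finally show "(\<integral>\<^sup>+ y. ennreal ((norm (x - y))\<^sup>2) \<partial>J (q x)) \<le> \<dots>" .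
    qed
    also have "\<dots> = (\<integral>\<^sup>+ w. (\<integral>\<^sup>+ p. ennreal ((\<epsilon> + norm (fst p - snd p))\<^sup>2) \<partial>U (Q w)) \<partial>\<pi>)"
      by (rule to_\<pi>)
    also have "\<dots> = (\<integral>\<^sup>+ p. ennreal ((\<epsilon> + norm (fst p - snd p))\<^sup>2) \<partial>\<pi>)"
      unfolding U_def by (rule nn_integral_cond_measure[OF \<pi>D(1) Q]) measurable
    \<comment> \<open>Minkowski for the constant \<epsilon> and the transport distance; total mass
      one makes the constant contribute \<epsilon>^2.\<close>
    also have "\<dots> \<le> ennreal ((\<epsilon> + a)\<^sup>2)"
      using \<pi>(2) a prob_space.emeasure_space_1[OF \<pi>D(1)]
      by (intro nn_integral_minkowski) (auto simp: cost_def less_imp_le)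
    finally show "(\<integral>\<^sup>+ x. (\<integral>\<^sup>+ y. ennreal ((norm (x - y))\<^sup>2) \<partial>J (q x)) \<partial>\<mu>) \<le> ennreal (c\<^sup>2)"
      using a by simp
  qed
qed

text \<open>The kernels of \<open>Ionescu_Tulcea\<close> receive the whole history; letting them
  read its last entry gives a Markov chain. Only transitions between consecutive coordinates are
  recorded, since these determine the laws and the consecutive costs.\<close>

lemma ex_markov_chain:
  fixes K :: "nat \<Rightarrow> 'a::euclidean_space \<Rightarrow> 'a measure"
  assumes \<mu>: "prob_space \<mu>" "sets \<mu> = sets borel"
    and K [measurable]: "\<And>n. K n \<in> borel \<rightarrow>\<^sub>M subprob_algebra borel"
    and K_prob: "\<And>n x. prob_space (K n x)"
  obtains \<Omega> :: "(nat \<Rightarrow> 'a) measure" where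
    "prob_space \<Omega>" "sets \<Omega> = sets (PiM UNIV (\<lambda>_. borel))" "distr \<Omega> borel (\<lambda>\<omega>. \<omega> 0) = \<mu>"
    "\<And>n h. h \<in> borel_measurable (borel \<Otimes>\<^sub>M borel) \<Longrightarrow>
      (\<integral>\<^sup>+ \<omega>. h (\<omega> n, \<omega> (Suc n)) \<partial>\<Omega>) = (\<integral>\<^sup>+ \<omega>. (\<integral>\<^sup>+ y. h (\<omega> n, y) \<partial>K n (\<omega> n)) \<partial>\<Omega>)"
proof -
  \<comment> \<open>\<open>P n\<close> produces coordinate \<open>n\<close> from coordinate
    \<open>n - 1\<close>; \<open>P 0\<close> draws from \<mu> after the empty history.\<close>
  define P where "P n \<omega> = (if n = 0 then \<mu> else K (n - 1) (\<omega> (n - 1)))" for n and \<omega> :: "nat \<Rightarrow> 'a"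
  have P0: "(\<lambda>\<omega>. \<mu>) \<in> M \<rightarrow>\<^sub>M subprob_algebra borel" for M :: "(nat \<Rightarrow> 'a) measure"
    using \<mu> by (intro measurable_const) (auto simp: space_subprob_algebra prob_space_imp_subprob_space)
  have P [measurable]: "P n \<in> PiM {0..<n} (\<lambda>_. borel) \<rightarrow>\<^sub>M subprob_algebra borel" for n
  proof (cases n)
    case (Suc m)
    have "(\<lambda>\<omega>. K m (\<omega> m)) \<in> PiM {0..<n} (\<lambda>_. borel) \<rightarrow>\<^sub>M subprob_algebra borel"
      by (rule measurable_compose[OF _ K], rule measurable_component_singleton) (simp add: Suc)
    then show ?thesis
      using Suc by (simp add: P_def[abs_def])
  qed (use P0 in \<open>simp add: P_def[abs_def]\<close>)
  interpret IT: Ionescu_Tulcea P "\<lambda>_. borel"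
  proof (rule Ionescu_Tulcea.intro)
    show "prob_space (P i x)" for i x
      by (simp add: P_def \<mu> K_prob)
  qed (rule P)
  \<comment> \<open>\<open>?C n\<close> is the law of the coordinates below \<open>n\<close>. It
    starts from the empty history: \<open>\<lambda>_. undefined\<close> is the only point of the
    product over the empty index set.\<close>
  let ?\<Omega> = "IT.PF.lim" and ?C = "\<lambda>n. IT.C 0 n (\<lambda>_. undefined)"
  have sets_\<Omega> [measurable_cong]: "sets ?\<Omega> = sets (PiM UNIV (\<lambda>_. borel))"
    by (rule IT.PF.sets_lim)
  have sets_C [measurable_cong]: "sets (?C n) = sets (PiM {0..<n} (\<lambda>_. borel))" for n
    by (subst IT.sets_C) auto
  \<comment> \<open>\<open>IT.emeasure_CI\<close> speaks of embedded cylinders; over the full index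
    set \<open>{0..<n}\<close> the embedding is the identity.\<close>
  have CI: "IT.CI {0..<n} = ?C n" for n
  proof (rule measure_eqI)
    fix X assume "X \<in> sets (IT.CI {0..<n})"
    then have X: "X \<in> sets (PiM {0..<n} (\<lambda>_. borel))"
      by (simp add: IT.PF.sets_P)
    then have "prod_emb {0..<n} (\<lambda>_. borel) {0..<n} X = X"
      using sets.sets_into_space[OF X] by (intro prod_emb_id) (simp add: space_PiM)
    then show "emeasure (IT.CI {0..<n}) X = emeasure (?C n) X"
      using IT.emeasure_CI[of "{0..<n}" n X] X by simp
  qed (simp add: IT.PF.sets_P sets_C)
  \<comment> \<open>Projecting to the empty index set preserves the total mass.\<close>
  have prob: "prob_space ?\<Omega>"
  proof (rule prob_space_distrD)
    show "prob_space (distr ?\<Omega> (PiM {} (\<lambda>_. borel)) (\<lambda>x. restrict x {}))"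
      by (simp add: IT.distr_lim IT.PF.prob_space_P)
  qed measurable
  have lim_C: "(\<integral>\<^sup>+ \<omega>. f \<omega> \<partial>?\<Omega>) = (\<integral>\<^sup>+ \<omega>. f \<omega> \<partial>(?C n))"
    if f: "f \<in> borel_measurable (PiM {0..<n} (\<lambda>_. borel))"
      and dep: "\<And>\<omega>. f (restrict \<omega> {0..<n}) = f \<omega>" for f :: "(nat \<Rightarrow> 'a) \<Rightarrow> ennreal" and n
  proof -
    have r: "(\<lambda>x. restrict x {0..<n}) \<in> ?\<Omega> \<rightarrow>\<^sub>M PiM {0..<n} (\<lambda>_. borel)"
      by measurable
    have "(\<integral>\<^sup>+ \<omega>. f \<omega> \<partial>(?C n))
        = (\<integral>\<^sup>+ \<omega>. f \<omega> \<partial>distr ?\<Omega> (PiM {0..<n} (\<lambda>_. borel)) (\<lambda>x. restrict x {0..<n}))"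
      by (simp add: IT.distr_lim CI)
    also have "\<dots> = (\<integral>\<^sup>+ \<omega>. f \<omega> \<partial>?\<Omega>)"
      using f r by (simp add: nn_integral_distr dep)
    finally show ?thesis ..
  qed
  have step: "(\<integral>\<^sup>+ \<omega>. f \<omega> \<partial>(?C (Suc n))) = (\<integral>\<^sup>+ \<omega>. (\<integral>\<^sup>+ y. f (fun_upd \<omega> n y) \<partial>P n \<omega>) \<partial>(?C n))"
    if f: "f \<in> borel_measurable (PiM {0..<Suc n} (\<lambda>_. borel))" for f :: "(nat \<Rightarrow> 'a) \<Rightarrow> ennreal" and n
  proof -
    have "(\<integral>\<^sup>+ \<omega>. f \<omega> \<partial>(?C (Suc n))) = (\<integral>\<^sup>+ \<omega>. (\<integral>\<^sup>+ \<omega>'. f \<omega>' \<partial>IT.eP n \<omega>) \<partial>(?C n))"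
      using f IT.measurable_eP[of n]
      by (simp add: nn_integral_bind[where B="PiM {0..<Suc n} (\<lambda>_. borel)"] measurable_cong_sets[OF sets_C refl])
    also have "\<dots> = (\<integral>\<^sup>+ \<omega>. (\<integral>\<^sup>+ y. f (fun_upd \<omega> n y) \<partial>P n \<omega>) \<partial>(?C n))"
      by (intro nn_integral_cong IT.nn_integral_eP f) (simp add: sets_eq_imp_space_eq[OF sets_C])
    finally show ?thesis .
  qed
  show ?thesis
  proof
    show "prob_space ?\<Omega>" "sets ?\<Omega> = sets (PiM UNIV (\<lambda>_. borel))"
      by (fact prob sets_\<Omega>)+
    show "distr ?\<Omega> borel (\<lambda>\<omega>. \<omega> 0) = \<mu>"
    proof (rule measure_eqI)
      fix A :: "'a set" assume "A \<in> sets (distr ?\<Omega> borel (\<lambda>\<omega>. \<omega> 0))"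
      then have A [measurable]: "A \<in> sets borel"
        by simp
      have "emeasure (distr ?\<Omega> borel (\<lambda>\<omega>. \<omega> 0)) A = (\<integral>\<^sup>+ x. indicator A x \<partial>distr ?\<Omega> borel (\<lambda>\<omega>. \<omega> 0))"
        by simp
      also have "\<dots> = (\<integral>\<^sup>+ \<omega>. indicator A (\<omega> 0) \<partial>?\<Omega>)"
        by (subst nn_integral_distr) auto
      also have "\<dots> = (\<integral>\<^sup>+ \<omega>. indicator A (\<omega> 0) \<partial>(?C (Suc 0)))"
        by (intro lim_C) auto
      also have "\<dots> = (\<integral>\<^sup>+ \<omega>. (\<integral>\<^sup>+ y. indicator A y \<partial>\<mu>) \<partial>(?C 0))"
        by (subst step) (auto simp: P_def)
      also have "\<dots> = emeasure \<mu> A"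
        using \<mu> by (simp add: nn_integral_return)
      finally show "emeasure (distr ?\<Omega> borel (\<lambda>\<omega>. \<omega> 0)) A = emeasure \<mu> A" .
    qed (simp add: \<mu>)
    show "(\<integral>\<^sup>+ \<omega>. h (\<omega> n, \<omega> (Suc n)) \<partial>?\<Omega>) = (\<integral>\<^sup>+ \<omega>. (\<integral>\<^sup>+ y. h (\<omega> n, y) \<partial>K n (\<omega> n)) \<partial>?\<Omega>)"
      if h [measurable]: "h \<in> borel_measurable (borel \<Otimes>\<^sub>M borel)" for n h
    proof -
      have [measurable]: "(\<lambda>x. \<integral>\<^sup>+ y. h (x, y) \<partial>K n x) \<in> borel_measurable borel"
        by (rule nn_integral_measurable_subprob_algebra2[where N=borel]) auto
      have "(\<integral>\<^sup>+ \<omega>. h (\<omega> n, \<omega> (Suc n)) \<partial>?\<Omega>) = (\<integral>\<^sup>+ \<omega>. h (\<omega> n, \<omega> (Suc n)) \<partial>(?C (Suc (Suc n))))"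
        by (intro lim_C) auto
      also have "\<dots> = (\<integral>\<^sup>+ \<omega>. (\<integral>\<^sup>+ y. h (\<omega> n, y) \<partial>K n (\<omega> n)) \<partial>(?C (Suc n)))"
        by (subst step) (auto simp: P_def)
      also have "\<dots> = (\<integral>\<^sup>+ \<omega>. (\<integral>\<^sup>+ y. h (\<omega> n, y) \<partial>K n (\<omega> n)) \<partial>?\<Omega>)"
        by (intro lim_C[symmetric]) auto
      finally show ?thesis .
    qed
  qed
qed

text \<open>By induction coordinate \<open>n\<close> has law \<open>\<mu> n\<close>, because
  \<open>K n\<close> carries \<open>\<mu> n\<close> to \<open>\<mu> (Suc n)\<close>; a consecutive
  cost is then the cost of the kernel. Having all variables on a single space is what makes almost
  sure convergence of the chain meaningful.\<close>

lemma W2_chain: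
  fixes \<mu> :: "nat \<Rightarrow> 'a::euclidean_space measure"
  assumes P2: "\<And>n. \<mu> n \<in> P2" and less: "\<And>n. W2 (\<mu> n) (\<mu> (Suc n)) < c n"
  obtains \<Omega> :: "(nat \<Rightarrow> 'a) measure" and X :: "nat \<Rightarrow> (nat \<Rightarrow> 'a) \<Rightarrow> 'a" where
    "prob_space \<Omega>" "\<And>n. X n \<in> borel_measurable \<Omega>" "\<And>n. distr \<Omega> borel (X n) = \<mu> n"
    "\<And>n. (\<integral>\<^sup>+ \<omega>. ennreal ((norm (X n \<omega> - X (Suc n) \<omega>))\<^sup>2) \<partial>\<Omega>) \<le> ennreal ((c n)\<^sup>2)"
proof -
  have "\<forall>n. \<exists>K. K \<in> borel \<rightarrow>\<^sub>M subprob_algebra borel \<and> (\<forall>x. prob_space (K x)) \<and>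
     (\<forall>h\<in>borel_measurable borel. (\<integral>\<^sup>+ x. (\<integral>\<^sup>+ y. h y \<partial>K x) \<partial>\<mu> n) = (\<integral>\<^sup>+ y. h y \<partial>\<mu> (Suc n))) \<and>
     (\<integral>\<^sup>+ x. (\<integral>\<^sup>+ y. ennreal ((norm (x - y))\<^sup>2) \<partial>K x) \<partial>\<mu> n) \<le> ennreal ((c n)\<^sup>2)"
  proof
    fix n
    show "\<exists>K. K \<in> borel \<rightarrow>\<^sub>M subprob_algebra borel \<and> (\<forall>x. prob_space (K x)) \<and>
     (\<forall>h\<in>borel_measurable borel. (\<integral>\<^sup>+ x. (\<integral>\<^sup>+ y. h y \<partial>K x) \<partial>\<mu> n) = (\<integral>\<^sup>+ y. h y \<partial>\<mu> (Suc n))) \<and>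
     (\<integral>\<^sup>+ x. (\<integral>\<^sup>+ y. ennreal ((norm (x - y))\<^sup>2) \<partial>K x) \<partial>\<mu> n) \<le> ennreal ((c n)\<^sup>2)"
      by (rule W2_less_kernel[OF P2[of n] P2[of "Suc n"] less[of n]]) blast
  qed
  from choice[OF this] obtain K where K [measurable]: "\<And>n. K n \<in> borel \<rightarrow>\<^sub>M subprob_algebra borel"
    and K_prob: "\<And>n x. prob_space (K n x)"
    and K_law: "\<And>n h. h \<in> borel_measurable borel \<Longrightarrow>
      (\<integral>\<^sup>+ x. (\<integral>\<^sup>+ y. h y \<partial>K n x) \<partial>\<mu> n) = (\<integral>\<^sup>+ y. h y \<partial>\<mu> (Suc n))"
    and K_cost: "\<And>n. (\<integral>\<^sup>+ x. (\<integral>\<^sup>+ y. ennreal ((norm (x - y))\<^sup>2) \<partial>K n x) \<partial>\<mu> n) \<le> ennreal ((c n)\<^sup>2)"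
    by blast
  obtain \<Omega> :: "(nat \<Rightarrow> 'a) measure" where \<Omega>: "prob_space \<Omega>"
    and [measurable_cong]: "sets \<Omega> = sets (PiM UNIV (\<lambda>_. borel))"
    and law0: "distr \<Omega> borel (\<lambda>\<omega>. \<omega> 0) = \<mu> 0"
    and step: "\<And>n h. h \<in> borel_measurable (borel \<Otimes>\<^sub>M borel) \<Longrightarrow>
      (\<integral>\<^sup>+ \<omega>. h (\<omega> n, \<omega> (Suc n)) \<partial>\<Omega>) = (\<integral>\<^sup>+ \<omega>. (\<integral>\<^sup>+ y. h (\<omega> n, y) \<partial>K n (\<omega> n)) \<partial>\<Omega>)"
    using ex_markov_chain[where K=K, OF P2D(1,2)[OF P2[of 0]] K K_prob] by blast
  have K_meas [measurable]: "(\<lambda>x. \<integral>\<^sup>+ y. h (x, y) \<partial>K n x) \<in> borel_measurable borel"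
    if [measurable]: "h \<in> borel_measurable (borel \<Otimes>\<^sub>M borel)" for h n
    by (rule nn_integral_measurable_subprob_algebra2[where N=borel]) auto
  have law: "distr \<Omega> borel (\<lambda>\<omega>. \<omega> n) = \<mu> n" for n
  proof (induction n)
    case (Suc n)
    show ?case
    proof (rule measure_eqI)
      fix A :: "'a set" assume "A \<in> sets (distr \<Omega> borel (\<lambda>\<omega>. \<omega> (Suc n)))"
      then have A [measurable]: "A \<in> sets borel"
        by simp
      have [measurable]: "(\<lambda>x. \<integral>\<^sup>+ y. indicator A y \<partial>K n x) \<in> borel_measurable borel"
        using K_meas[of "\<lambda>p. indicator A (snd p)" n] by simp
      have "emeasure (distr \<Omega> borel (\<lambda>\<omega>. \<omega> (Suc n))) A = (\<integral>\<^sup>+ x. indicator A x \<partial>distr \<Omega> borel (\<lambda>\<omega>. \<omega> (Suc n)))"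
        by simp
      also have "\<dots> = (\<integral>\<^sup>+ \<omega>. indicator A (\<omega> (Suc n)) \<partial>\<Omega>)"
        by (subst nn_integral_distr) auto
      also have "\<dots> = (\<integral>\<^sup>+ \<omega>. (\<integral>\<^sup>+ y. indicator A y \<partial>K n (\<omega> n)) \<partial>\<Omega>)"
        using step[of "\<lambda>p. indicator A (snd p)" n] by simp
      also have "\<dots> = (\<integral>\<^sup>+ x. (\<integral>\<^sup>+ y. indicator A y \<partial>K n x) \<partial>\<mu> n)"
        by (subst Suc.IH[symmetric], subst nn_integral_distr) auto
      also have "\<dots> = (\<integral>\<^sup>+ y. indicator A y \<partial>\<mu> (Suc n))"
        by (rule K_law) simp
      also have "\<dots> = emeasure (\<mu> (Suc n)) A"
        using P2D(2)[OF P2] by simp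
      finally show "emeasure (distr \<Omega> borel (\<lambda>\<omega>. \<omega> (Suc n))) A = emeasure (\<mu> (Suc n)) A" .
    qed (simp add: P2D(2)[OF P2])
  qed (fact law0)
  show ?thesis
  proof
    show "(\<integral>\<^sup>+ \<omega>. ennreal ((norm (\<omega> n - \<omega> (Suc n)))\<^sup>2) \<partial>\<Omega>) \<le> ennreal ((c n)\<^sup>2)" for n
    proof -
      have [measurable]: "(\<lambda>x. \<integral>\<^sup>+ y. ennreal ((norm (x - y))\<^sup>2) \<partial>K n x) \<in> borel_measurable borel"
        using K_meas[of "\<lambda>p. ennreal ((norm (fst p - snd p))\<^sup>2)" n] by simp
      have "(\<integral>\<^sup>+ \<omega>. ennreal ((norm (\<omega> n - \<omega> (Suc n)))\<^sup>2) \<partial>\<Omega>)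
          = (\<integral>\<^sup>+ \<omega>. (\<integral>\<^sup>+ y. ennreal ((norm (\<omega> n - y))\<^sup>2) \<partial>K n (\<omega> n)) \<partial>\<Omega>)"
        using step[of "\<lambda>p. ennreal ((norm (fst p - snd p))\<^sup>2)" n] by simp
      also have "\<dots> = (\<integral>\<^sup>+ x. (\<integral>\<^sup>+ y. ennreal ((norm (x - y))\<^sup>2) \<partial>K n x) \<partial>\<mu> n)"
        by (subst law[symmetric], subst nn_integral_distr) auto
      finally show ?thesis
        using K_cost by simp
    qed
  qed (auto simp: \<Omega> law)
qed

section \<open>The metric axioms\<close>

lemma W2_self: "W2 \<mu> \<mu> = 0" if "\<mu> \<in> P2" for \<mu> :: "'a::euclidean_space measure"
proof -
  note [measurable_cong] = P2D(2)[OF that]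
  have "distr \<mu> borel (\<lambda>x. x) = \<mu>"
    using P2D(2)[OF that] by (metis distr_cong distr_id2)
  then have "W2 \<mu> \<mu> \<le> 0"
    using P2D(1)[OF that]
    by (intro W2_le_of_random_variables[where \<Omega>=\<mu> and X="\<lambda>x. x" and Y="\<lambda>x. x"]) auto
  then show ?thesis
    using W2_nonneg[of \<mu> \<mu>] by simp
qed

lemma W2_triangle:
  fixes \<mu> \<nu> \<rho> :: "'a::euclidean_space measure"
  assumes "\<mu> \<in> P2" "\<nu> \<in> P2" "\<rho> \<in> P2"
  shows "W2 \<mu> \<rho> \<le> W2 \<mu> \<nu> + W2 \<nu> \<rho>"
proof (rule field_le_epsilon)
  fix e :: real assume e: "0 < e"
  \<comment> \<open>Only the first two steps of the chain matter; from index 2 on the sequence is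
    constant. The slack \<open>e / 2\<close> per step makes the bounds strict and positive.\<close>
  define \<sigma> where "\<sigma> n = (if n = 0 then \<mu> else if n = 1 then \<nu> else \<rho>)" for n :: nat
  have \<sigma>: "\<sigma> n \<in> P2" for n
    using assms by (simp add: \<sigma>_def)
  define c where "c n = W2 (\<sigma> n) (\<sigma> (Suc n)) + e / 2" for n
  have less: "W2 (\<sigma> n) (\<sigma> (Suc n)) < c n" for n
    using e by (simp add: c_def)
  then have pos: "0 < c n" for n
    using W2_nonneg by (metis le_less_trans)
  obtain \<Omega> :: "(nat \<Rightarrow> 'a) measure" and X where "prob_space \<Omega>"
    and X: "\<And>n. X n \<in> borel_measurable \<Omega>" "\<And>n. distr \<Omega> borel (X n) = \<sigma> n"
    "\<And>n. (\<integral>\<^sup>+ \<omega>. ennreal ((norm (X n \<omega> - X (Suc n) \<omega>))\<^sup>2) \<partial>\<Omega>) \<le> ennreal ((c n)\<^sup>2)"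
    using W2_chain[where \<mu>=\<sigma> and c=c, OF \<sigma> less] by blast
  have "(\<integral>\<^sup>+ \<omega>. ennreal ((norm (X 0 \<omega> - X (Suc (Suc 0)) \<omega>))\<^sup>2) \<partial>\<Omega>) \<le> ennreal ((c 0 + c (Suc 0))\<^sup>2)"
    by (rule nn_integral_minkowski_dist[where Y="X (Suc 0)"]) (use X pos in auto)
  then have "W2 (\<sigma> 0) (\<sigma> (Suc (Suc 0))) \<le> c 0 + c (Suc 0)"
    using \<open>prob_space \<Omega>\<close> X(1,2) pos[of 0] pos[of "Suc 0"]
    by (intro W2_le_of_random_variables[of \<Omega> "X 0" "X (Suc (Suc 0))"]) auto
  then show "W2 \<mu> \<rho> \<le> W2 \<mu> \<nu> + W2 \<nu> \<rho> + e"
    by (simp add: c_def \<sigma>_def)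
qed

text \<open>A cheap coupling moves little mass by more than \<open>d n\<close>. So the mass of
  \<open>F\<close> under \<mu> is at most that of a closed neighbourhood under \<nu> plus a small
  error, and the neighbourhoods shrink to \<open>F\<close> because \<open>F\<close> is closed.
  \<open>F \<noteq> {}\<close> is there because \<open>infdist\<close> to the empty set is
  0.\<close>

lemma W2_eq_0_imp_closed_le:
  fixes \<mu> \<nu> :: "'a::euclidean_space measure"
  assumes "\<mu> \<in> P2" "\<nu> \<in> P2" "W2 \<mu> \<nu> = 0" "closed F" "F \<noteq> {}"
  shows "measure \<mu> F \<le> measure \<nu> F"
proof -
  interpret \<nu>: prob_space \<nu>
    using P2D(1)[OF assms(2)] .
  note [measurable_cong] = P2D(2)[OF assms(1)] P2D(2)[OF assms(2)]
  define d where "d n = 1 / real (Suc n)" for n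
  have d: "0 < d n" for n
    by (simp add: d_def)
  have [measurable]: "F \<in> sets borel"
    using \<open>closed F\<close> by simp
  define N where "N n = {y. infdist y F \<le> d n}" for n
  have N [measurable]: "N n \<in> sets borel" for n
    unfolding N_def by (intro borel_closed closed_Collect_le continuous_intros)
  have le: "measure \<mu> F \<le> measure \<nu> (N n) + (d n)\<^sup>2" for n
  proof -
    \<comment> \<open>This makes the cost smaller than the fourth power of \<open>d n\<close>;
      Markov's inequality divides by the square, and the remaining square still tends to 0.\<close>
    have "W2 \<mu> \<nu> < (d n)\<^sup>2"
      using d[of n] assms(3) by simp
    then obtain \<pi> where \<pi>: "\<pi> \<in> couplings \<mu> \<nu>" "cost \<pi> < ennreal (((d n)\<^sup>2)\<^sup>2)"
      using W2_lessD[OF assms(1,2)] by metis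
    note \<pi>D = couplingsD[OF \<pi>(1)]
    note [measurable_cong] = \<pi>D(2)
    interpret \<pi>: prob_space \<pi> by (fact \<pi>D)
    have sp: "space \<pi> = UNIV"
      using sets_eq_imp_space_eq[OF \<pi>D(2)] by simp
    have far: "emeasure \<pi> {p. d n < norm (fst p - snd p)} \<le> ennreal ((d n)\<^sup>2)"
    proof -
      have "emeasure \<pi> {p. d n < norm (fst p - snd p)}
          \<le> emeasure \<pi> {p\<in>space \<pi>. 1 \<le> ennreal (1 / (d n)\<^sup>2) * ennreal ((norm (fst p - snd p))\<^sup>2)}"
      proof (rule emeasure_mono)
        show "{p. d n < norm (fst p - snd p)}
            \<subseteq> {p\<in>space \<pi>. 1 \<le> ennreal (1 / (d n)\<^sup>2) * ennreal ((norm (fst p - snd p))\<^sup>2)}"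
        proof
          fix p :: "'a \<times> 'a" assume "p \<in> {p. d n < norm (fst p - snd p)}"
          then have "(d n)\<^sup>2 \<le> (norm (fst p - snd p))\<^sup>2"
            using d[of n] by (intro power_mono) auto
          then have "1 \<le> 1 / (d n)\<^sup>2 * (norm (fst p - snd p))\<^sup>2"
            using d[of n] by (simp add: field_simps)
          then show "p \<in> {p\<in>space \<pi>. 1 \<le> ennreal (1 / (d n)\<^sup>2) * ennreal ((norm (fst p - snd p))\<^sup>2)}"
            by (simp add: sp ennreal_mult[symmetric] del: times_divide_eq_left)
        qed
      qed measurable
      also have "\<dots> \<le> ennreal (1 / (d n)\<^sup>2) * (\<integral>\<^sup>+ p. ennreal ((norm (fst p - snd p))\<^sup>2) * indicator (space \<pi>) p \<partial>\<pi>)"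
        by (intro nn_integral_Markov_inequality) auto
      also have "\<dots> = ennreal (1 / (d n)\<^sup>2) * cost \<pi>"
        by (simp add: cost_def sp)
      also have "\<dots> \<le> ennreal (1 / (d n)\<^sup>2) * ennreal (((d n)\<^sup>2)\<^sup>2)"
        using \<pi>(2) by (intro mult_left_mono) auto
      also have "\<dots> = ennreal ((d n)\<^sup>2)"
        using d[of n] by (simp add: ennreal_mult[symmetric] power2_eq_square)
      finally show ?thesis .
    qed
    have "measure \<mu> F = measure \<pi> {p. fst p \<in> F}"
      by (subst \<pi>D(3)[symmetric], subst measure_distr) (auto simp: sp vimage_def)
    also have "\<dots> \<le> measure \<pi> ({p. snd p \<in> N n} \<union> {p. d n < norm (fst p - snd p)})"
    proof (rule \<pi>.finite_measure_mono)
      show "{p. fst p \<in> F} \<subseteq> {p. snd p \<in> N n} \<union> {p. d n < norm (fst p - snd p)}"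
      proof
        fix p :: "'a \<times> 'a" assume "p \<in> {p. fst p \<in> F}"
        then have "infdist (snd p) F \<le> norm (fst p - snd p)"
          by (metis dist_commute dist_norm infdist_le mem_Collect_eq)
        then show "p \<in> {p. snd p \<in> N n} \<union> {p. d n < norm (fst p - snd p)}"
          by (auto simp: N_def)
      qed
      have "{p. snd p \<in> N n} = {p\<in>space \<pi>. snd p \<in> N n}" "{p. d n < norm (fst p - snd p)} = {p\<in>space \<pi>. d n < norm (fst p - snd p)}"
        by (auto simp: sp)
      then show "{p. snd p \<in> N n} \<union> {p. d n < norm (fst p - snd p)} \<in> \<pi>.events"
        by simp
    qed
    also have "\<dots> \<le> measure \<pi> {p. snd p \<in> N n} + measure \<pi> {p. d n < norm (fst p - snd p)}"
    proof (rule measure_Un_le)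
      have "{p. snd p \<in> N n} = {p\<in>space \<pi>. snd p \<in> N n}" "{p. d n < norm (fst p - snd p)} = {p\<in>space \<pi>. d n < norm (fst p - snd p)}"
        by (auto simp: sp)
      then show "{p. snd p \<in> N n} \<in> \<pi>.events" "{p. d n < norm (fst p - snd p)} \<in> \<pi>.events"
        by simp_all
    qed
    also have "measure \<pi> {p. snd p \<in> N n} = measure \<nu> (N n)"
      by (subst \<pi>D(4)[symmetric], subst measure_distr) (auto simp: sp vimage_def)
    also have "measure \<pi> {p. d n < norm (fst p - snd p)} \<le> (d n)\<^sup>2"
      using far by (simp add: \<pi>.emeasure_eq_measure)
    finally show ?thesis by simp
  qed
  have "(\<lambda>n. measure \<nu> (N n)) \<longlonglongrightarrow> measure \<nu> (\<Inter>n. N n)"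
  proof (rule \<nu>.finite_Lim_measure_decseq)
    show "decseq N"
      by (auto simp: decseq_def N_def d_def elim!: order_trans intro!: divide_left_mono)
  qed auto
  moreover have "(\<Inter>n. N n) = F"
  proof
    show "(\<Inter>n. N n) \<subseteq> F"
    proof
      fix y assume "y \<in> (\<Inter>n. N n)"
      then have "infdist y F \<le> d n" for n
        by (simp add: N_def)
      moreover have "d \<longlonglongrightarrow> 0"
        unfolding d_def[abs_def] by (rule LIMSEQ_inverse_real_of_nat[unfolded inverse_eq_divide])
      ultimately have "infdist y F \<le> 0"
        by (metis LIMSEQ_le_const)
      then show "y \<in> F"
        using \<open>closed F\<close> \<open>F \<noteq> {}\<close> infdist_nonneg[of y F] by (simp add: in_closed_iff_infdist_zero)
    qed
    show "F \<subseteq> (\<Inter>n. N n)"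
      using d by (auto simp: N_def less_imp_le)
  qed
  moreover have "(\<lambda>n. (d n)\<^sup>2) \<longlonglongrightarrow> 0\<^sup>2"
    unfolding d_def by (intro tendsto_power LIMSEQ_inverse_real_of_nat[unfolded inverse_eq_divide])
  ultimately have "(\<lambda>n. measure \<nu> (N n) + (d n)\<^sup>2) \<longlonglongrightarrow> measure \<nu> F + 0\<^sup>2"
    by (intro tendsto_add) auto
  then have "measure \<mu> F \<le> measure \<nu> F + 0\<^sup>2"
    by (rule LIMSEQ_le_const) (use le in auto)
  then show ?thesis by simp
qed

text \<open>Symmetry of \<open>W2\<close> turns the comparison on closed sets into equality, and the
  closed sets are an intersection-stable generator of the Borel sets.\<close>

lemma W2_eq_0_imp_eq:
  fixes \<mu> \<nu> :: "'a::euclidean_space measure"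
  assumes "\<mu> \<in> P2" "\<nu> \<in> P2" "W2 \<mu> \<nu> = 0"
  shows "\<mu> = \<nu>"
proof -
  interpret \<mu>: prob_space \<mu>
    using P2D(1)[OF assms(1)] .
  interpret \<nu>: prob_space \<nu>
    using P2D(1)[OF assms(2)] .
  have "measure \<mu> F = measure \<nu> F" if "closed F" for F
    using W2_eq_0_imp_closed_le[OF assms that] that
      W2_eq_0_imp_closed_le[OF assms(2,1) _ that] assms(3) W2_commute[of \<mu> \<nu>]
    by (cases "F = {}") auto
  then have eq: "emeasure \<mu> F = emeasure \<nu> F" if "closed F" for F
    using that by (simp add: \<mu>.emeasure_eq_measure \<nu>.emeasure_eq_measure)
  have borel: "sets (borel :: 'a measure) = sigma_sets UNIV (Collect closed)"
    by (simp add: borel_eq_closed)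
  show ?thesis
  proof (rule measure_eqI_generator_eq[where E="Collect closed" and \<Omega>=UNIV and A="\<lambda>_. UNIV"])
    show "Int_stable (Collect closed :: 'a set set)"
      by (auto simp: Int_stable_def)
    show "sets \<mu> = sigma_sets UNIV (Collect closed)" "sets \<nu> = sigma_sets UNIV (Collect closed)"
      using assms(1,2) borel by (auto dest: P2D)
  qed (auto simp: eq)
qed

lemma Metric_space_P2: "Metric_space (P2 :: 'a::euclidean_space measure set) W2"
  using W2_eq_0_imp_eq W2_self
  by unfold_locales (auto simp: W2_nonneg intro: W2_commute W2_triangle)

section \<open>Translations and dilations\<close>

definition second_moment :: "'a::euclidean_space measure \<Rightarrow> real" where
  "second_moment \<mu> = (\<integral>x. (norm x)\<^sup>2 \<partial>\<mu>)"

definition mean :: "'a::euclidean_space measure \<Rightarrow> 'a" where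
  "mean \<mu> = (\<integral>x. x \<partial>\<mu>)"

definition translate :: "'a \<Rightarrow> 'a::euclidean_space measure \<Rightarrow> 'a measure" where
  "translate a \<mu> = distr \<mu> borel (\<lambda>x. x + a)"

definition dilate :: "real \<Rightarrow> 'a::euclidean_space measure \<Rightarrow> 'a measure" where
  "dilate s \<mu> = distr \<mu> borel (\<lambda>x. s *\<^sub>R x)"

lemma measurable_P2:
  assumes "\<mu> \<in> P2" "f \<in> borel \<rightarrow>\<^sub>M N"
  shows "f \<in> \<mu> \<rightarrow>\<^sub>M N"
  using assms measurable_cong_sets[OF P2D(2)[OF assms(1)] refl] by blast

lemma distr_P2:
  fixes f :: "'a::euclidean_space \<Rightarrow> 'a"
  assumes "\<mu> \<in> P2" and f: "f \<in> borel_measurable borel" and "integrable \<mu> (\<lambda>x. (norm (f x))\<^sup>2)"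
  shows "distr \<mu> borel f \<in> P2"
  using assms measurable_P2[OF assms(1) f] prob_space.prob_space_distr[OF P2D(1)[OF assms(1)]]
  by (auto simp: P2_def integrable_distr_eq)

lemma integrable_P2_norm: "integrable \<mu> (\<lambda>x. norm x)" if "\<mu> \<in> P2" for \<mu> :: "'a::euclidean_space measure"
proof (rule Bochner_Integration.integrable_bound)
  interpret prob_space \<mu> by (rule P2D(1)[OF that])
  show "integrable \<mu> (\<lambda>x. 1 + (norm x)\<^sup>2)"
    using P2D(3)[OF that] by simp
  show "(\<lambda>x. norm x) \<in> borel_measurable \<mu>"
    by (rule measurable_P2[OF that]) simp
  have "t \<le> 1 + t\<^sup>2" for t :: real
  proof -
    have "0 \<le> ((t - 1)\<^sup>2 + t\<^sup>2 + 1) / 2"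
      by (intro divide_nonneg_pos add_nonneg_nonneg) auto
    also have "\<dots> = 1 + t\<^sup>2 - t"
      by (simp add: power2_eq_square field_simps)
    finally show ?thesis by simp
  qed
  then show "AE x in \<mu>. norm (norm x) \<le> norm (1 + (norm x)\<^sup>2)"
    by (simp add: abs_of_nonneg add_nonneg_nonneg)
qed

lemma integrable_P2_id: "integrable \<mu> (\<lambda>x. x)" if "\<mu> \<in> P2" for \<mu> :: "'a::euclidean_space measure"
  by (rule integrable_norm_cancel[OF integrable_P2_norm[OF that]], rule measurable_P2[OF that]) simp

lemma translate_P2: "translate a \<mu> \<in> P2" if "\<mu> \<in> P2" for \<mu> :: "'a::euclidean_space measure"
proof -
  interpret prob_space \<mu> by (rule P2D(1)[OF that])
  have "(\<lambda>x. (norm (x + a))\<^sup>2) = (\<lambda>x. (norm x)\<^sup>2 + 2 * (x \<bullet> a) + (norm a)\<^sup>2)"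
    by (simp add: fun_eq_iff power2_norm_eq_inner inner_add_left inner_add_right inner_commute)
  moreover have "integrable \<mu> (\<lambda>x. (norm x)\<^sup>2 + 2 * (x \<bullet> a) + (norm a)\<^sup>2)"
    using P2D(3)[OF that] integrable_P2_id[OF that] by simp
  ultimately show ?thesis
    unfolding translate_def using that by (intro distr_P2) auto
qed

lemma dilate_P2: "dilate s \<mu> \<in> P2" if "\<mu> \<in> P2" for \<mu> :: "'a::euclidean_space measure"
  unfolding dilate_def using that P2D(3)[OF that]
  by (intro distr_P2) (auto simp: power_mult_distrib)

lemma mean_translate: "mean (translate a \<mu>) = mean \<mu> + a" if "\<mu> \<in> P2" for \<mu> :: "'a::euclidean_space measure"
proof -
  interpret prob_space \<mu> by (rule P2D(1)[OF that])
  have m: "(\<lambda>x. x + a) \<in> \<mu> \<rightarrow>\<^sub>M borel"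
    by (rule measurable_P2[OF that]) simp
  have "mean (translate a \<mu>) = (\<integral>x. x + a \<partial>\<mu>)"
    unfolding mean_def translate_def by (rule integral_distr[OF m]) simp
  also have "\<dots> = (\<integral>x. x \<partial>\<mu>) + (\<integral>x. a \<partial>\<mu>)"
    by (rule Bochner_Integration.integral_add[OF integrable_P2_id[OF that] integrable_const])
  also have "(\<integral>x. a \<partial>\<mu>) = a"
    by (simp add: prob_space)
  finally show ?thesis
    by (simp add: mean_def)
qed

lemma second_moment_dilate: "second_moment (dilate s \<mu>) = s\<^sup>2 * second_moment \<mu>" if "\<mu> \<in> P2"
  for \<mu> :: "'a::euclidean_space measure"
proof -
  have m: "(\<lambda>x. s *\<^sub>R x) \<in> \<mu> \<rightarrow>\<^sub>M borel"
    by (rule measurable_P2[OF that]) simp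
  have "second_moment (dilate s \<mu>) = (\<integral>x. (norm (s *\<^sub>R x))\<^sup>2 \<partial>\<mu>)"
    unfolding second_moment_def dilate_def by (rule integral_distr[OF m]) simp
  then show ?thesis
    by (simp add: second_moment_def power_mult_distrib)
qed

lemma distr_P2_ident: "distr \<mu> borel (\<lambda>x. x) = \<mu>" if "\<mu> \<in> P2" for \<mu> :: "'a::euclidean_space measure"
  using distr_id2[OF P2D(2)[OF that, symmetric]] by simp

lemma translate_translate: "translate a (translate b \<mu>) = translate (a + b) \<mu>" if "\<mu> \<in> P2"
  for \<mu> :: "'a::euclidean_space measure"
proof -
  have m: "(\<lambda>x. x + b) \<in> \<mu> \<rightarrow>\<^sub>M borel"
    by (rule measurable_P2[OF that]) simp
  have "distr (distr \<mu> borel (\<lambda>x. x + b)) borel (\<lambda>x. x + a) = distr \<mu> borel ((\<lambda>x. x + a) \<circ> (\<lambda>x. x + b))"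
    by (rule distr_distr[OF _ m]) simp
  then show ?thesis
    by (simp add: translate_def comp_def add_ac)
qed

lemma translate_0: "translate 0 \<mu> = \<mu>" if "\<mu> \<in> P2" for \<mu> :: "'a::euclidean_space measure"
  using distr_P2_ident[OF that] by (simp add: translate_def)

lemma dilate_dilate: "dilate s (dilate t \<mu>) = dilate (s * t) \<mu>" if "\<mu> \<in> P2"
  for \<mu> :: "'a::euclidean_space measure"
proof -
  have m: "(\<lambda>x. t *\<^sub>R x) \<in> \<mu> \<rightarrow>\<^sub>M borel"
    by (rule measurable_P2[OF that]) simp
  have "distr (distr \<mu> borel (\<lambda>x. t *\<^sub>R x)) borel (\<lambda>x. s *\<^sub>R x) = distr \<mu> borel ((\<lambda>x. s *\<^sub>R x) \<circ> (\<lambda>x. t *\<^sub>R x))"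
    by (rule distr_distr[OF _ m]) simp
  then show ?thesis
    by (simp add: dilate_def comp_def)
qed

lemma dilate_1: "dilate 1 \<mu> = \<mu>" if "\<mu> \<in> P2" for \<mu> :: "'a::euclidean_space measure"
  using distr_P2_ident[OF that] by (simp add: dilate_def)

lemma second_moment_nonneg: "0 \<le> second_moment \<mu>"
  by (simp add: second_moment_def)

text \<open>Passage from \<open>ennreal\<close> to Bochner integrals: expanding squares produces
  terms of either sign.\<close>

lemma integral_cost:
  fixes \<mu> \<nu> :: "'a::euclidean_space measure"
  assumes "\<mu> \<in> P2" "\<nu> \<in> P2" and \<pi>: "\<pi> \<in> couplings \<mu> \<nu>"
  shows "integrable \<pi> (\<lambda>p. (norm (fst p - snd p))\<^sup>2)"
    and "cost \<pi> = ennreal (\<integral>p. (norm (fst p - snd p))\<^sup>2 \<partial>\<pi>)"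
proof -
  note [measurable_cong] = couplingsD(2)[OF \<pi>]
  have "(\<lambda>p. (norm (fst p - snd p))\<^sup>2) \<in> borel_measurable \<pi>"
    by measurable
  then show int: "integrable \<pi> (\<lambda>p. (norm (fst p - snd p))\<^sup>2)"
    using cost_finite[OF assms] by (simp add: integrable_iff_bounded cost_def)
  show "cost \<pi> = ennreal (\<integral>p. (norm (fst p - snd p))\<^sup>2 \<partial>\<pi>)"
    unfolding cost_def by (rule nn_integral_eq_integral[OF int]) simp
qed

lemma integral_coupling:
  fixes \<mu> \<nu> :: "'a::euclidean_space measure" and u v :: "'a \<Rightarrow> 'b::{banach, second_countable_topology}"
  assumes "\<mu> \<in> P2" "\<nu> \<in> P2" and \<pi>: "\<pi> \<in> couplings \<mu> \<nu>"
    and "integrable \<mu> u" "integrable \<nu> v"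
  shows "integrable \<pi> (\<lambda>p. u (fst p))" "(\<integral>p. u (fst p) \<partial>\<pi>) = (\<integral>x. u x \<partial>\<mu>)"
    and "integrable \<pi> (\<lambda>p. v (snd p))" "(\<integral>p. v (snd p) \<partial>\<pi>) = (\<integral>y. v y \<partial>\<nu>)"
proof -
  note \<pi>D = couplingsD[OF \<pi>]
  note [measurable_cong] = \<pi>D(2)
  have m: "fst \<in> \<pi> \<rightarrow>\<^sub>M borel" "snd \<in> \<pi> \<rightarrow>\<^sub>M borel"
    by measurable
  have uv: "u \<in> borel_measurable borel" "v \<in> borel_measurable borel"
    using borel_measurable_integrable[OF assms(4)] borel_measurable_integrable[OF assms(5)]
      measurable_cong_sets[OF P2D(2)[OF assms(1)] refl] measurable_cong_sets[OF P2D(2)[OF assms(2)] refl]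
    by blast+
  show "integrable \<pi> (\<lambda>p. u (fst p))" "integrable \<pi> (\<lambda>p. v (snd p))"
    using assms(4,5) integrable_distr_eq[OF m(1) uv(1)] integrable_distr_eq[OF m(2) uv(2)]
    by (simp_all add: \<pi>D)
  show "(\<integral>p. u (fst p) \<partial>\<pi>) = (\<integral>x. u x \<partial>\<mu>)" "(\<integral>p. v (snd p) \<partial>\<pi>) = (\<integral>y. v y \<partial>\<nu>)"
    using integral_distr[OF m(1) uv(1)] integral_distr[OF m(2) uv(2)] by (simp_all add: \<pi>D)
qed

lemma W2_square_le_cost:
  assumes "\<mu> \<in> P2" "\<nu> \<in> P2" "\<pi> \<in> couplings \<mu> \<nu>"
  shows "(W2 \<mu> \<nu>)\<^sup>2 \<le> (\<integral>p. (norm (fst p - snd p))\<^sup>2 \<partial>\<pi>)"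
proof -
  have nn: "0 \<le> (\<integral>p. (norm (fst p - snd p))\<^sup>2 \<partial>\<pi>)"
    by simp
  have "W2 \<mu> \<nu> \<le> sqrt (\<integral>p. (norm (fst p - snd p))\<^sup>2 \<partial>\<pi>)"
    using integral_cost(2)[OF assms] nn by (intro W2_le_cost[OF assms(3)]) simp_all
  then show ?thesis
    using W2_nonneg[of \<mu> \<nu>] nn by (metis power_mono real_sqrt_pow2)
qed

lemma W2_square_approx:
  assumes "\<mu> \<in> P2" "\<nu> \<in> P2" "0 < e"
  obtains \<pi> where "\<pi> \<in> couplings \<mu> \<nu>" "(\<integral>p. (norm (fst p - snd p))\<^sup>2 \<partial>\<pi>) \<le> (W2 \<mu> \<nu>)\<^sup>2 + e"
proof -
  define c where "c = sqrt ((W2 \<mu> \<nu>)\<^sup>2 + e)"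
  have c: "W2 \<mu> \<nu> < c" "c\<^sup>2 = (W2 \<mu> \<nu>)\<^sup>2 + e"
    using \<open>0 < e\<close> by (auto simp: c_def real_less_rsqrt)
  then obtain \<pi> where \<pi>: "\<pi> \<in> couplings \<mu> \<nu>" "cost \<pi> < ennreal (c\<^sup>2)"
    using W2_lessD[OF assms(1,2)] by metis
  then have "ennreal (\<integral>p. (norm (fst p - snd p))\<^sup>2 \<partial>\<pi>) \<le> ennreal (c\<^sup>2)"
    using integral_cost(2)[OF assms(1,2) \<pi>(1)] by (metis less_imp_le)
  then have "(\<integral>p. (norm (fst p - snd p))\<^sup>2 \<partial>\<pi>) \<le> c\<^sup>2"
    by (simp add: ennreal_le_iff)
  then show ?thesis
    using that[OF \<pi>(1)] c by simp
qed

text \<open>If \<open>f\<close> and \<open>g\<close> are invertible, applying this to the inverses as well gives equality.\<close>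

lemma W2_distr_le:
  fixes f g :: "'a::euclidean_space \<Rightarrow> 'a"
  assumes P2: "\<mu> \<in> P2" "\<nu> \<in> P2" "distr \<mu> borel f \<in> P2" "distr \<nu> borel g \<in> P2"
    and [measurable]: "f \<in> borel_measurable borel" "g \<in> borel_measurable borel"
    and uv: "integrable \<mu> u" "integrable \<nu> v" and k: "0 \<le> k"
    and eq: "\<And>x y. (norm (f x - g y))\<^sup>2 = k * (norm (x - y))\<^sup>2 + u x + v y"
  shows "(W2 (distr \<mu> borel f) (distr \<nu> borel g))\<^sup>2
    \<le> k * (W2 \<mu> \<nu>)\<^sup>2 + (\<integral>x. u x \<partial>\<mu>) + (\<integral>y. v y \<partial>\<nu>)"
proof (rule field_le_epsilon)
  fix e :: real assume e: "0 < e"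
  \<comment> \<open>The added 1 gives \<open>k * e' \<le> e\<close> and keeps the divisor positive
    when \<open>k = 0\<close>.\<close>
  define e' where "e' = e / (k + 1)"
  have e': "0 < e'" "k * e' \<le> e"
    using e k by (auto simp: e'_def field_simps)
  obtain \<pi> where \<pi>: "\<pi> \<in> couplings \<mu> \<nu>" "(\<integral>p. (norm (fst p - snd p))\<^sup>2 \<partial>\<pi>) \<le> (W2 \<mu> \<nu>)\<^sup>2 + e'"
    using W2_square_approx[OF P2(1,2) e'(1)] .
  note \<pi>D = couplingsD[OF \<pi>(1)]
  note [measurable_cong] = \<pi>D(2)
  let ?\<pi> = "distr \<pi> borel (\<lambda>p. (f (fst p), g (snd p)))"
  have m: "(\<lambda>p. f (fst p)) \<in> borel_measurable \<pi>" "(\<lambda>p. g (snd p)) \<in> borel_measurable \<pi>"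
    by measurable
  have d: "distr \<pi> borel (\<lambda>p. f (fst p)) = distr \<mu> borel f"
    "distr \<pi> borel (\<lambda>p. g (snd p)) = distr \<nu> borel g"
    by (subst \<pi>D(3,4)[symmetric], subst distr_distr, auto simp: comp_def)+
  have c: "?\<pi> \<in> couplings (distr \<mu> borel f) (distr \<nu> borel g)"
    using coupling_distr[OF \<pi>D(1) m] by (simp add: d)
  have [measurable]: "(\<lambda>p. (f (fst p), g (snd p))) \<in> \<pi> \<rightarrow>\<^sub>M borel"
    using m by measurable
  note int = integral_coupling[OF P2(1,2) \<pi>(1) uv] integral_cost(1)[OF P2(1,2) \<pi>(1)]
  have "(W2 (distr \<mu> borel f) (distr \<nu> borel g))\<^sup>2 \<le> (\<integral>p. (norm (fst p - snd p))\<^sup>2 \<partial>?\<pi>)"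
    by (rule W2_square_le_cost[OF P2(3,4) c])
  also have "\<dots> = (\<integral>p. (norm (f (fst p) - g (snd p)))\<^sup>2 \<partial>\<pi>)"
    by (subst integral_distr) auto
  also have "\<dots> = k * (\<integral>p. (norm (fst p - snd p))\<^sup>2 \<partial>\<pi>) + (\<integral>x. u x \<partial>\<mu>) + (\<integral>y. v y \<partial>\<nu>)"
    using int by (simp add: eq)
  also have "\<dots> \<le> k * ((W2 \<mu> \<nu>)\<^sup>2 + e') + (\<integral>x. u x \<partial>\<mu>) + (\<integral>y. v y \<partial>\<nu>)"
    using \<pi>(2) k by (intro add_right_mono mult_left_mono)
  also have "\<dots> \<le> k * (W2 \<mu> \<nu>)\<^sup>2 + (\<integral>x. u x \<partial>\<mu>) + (\<integral>y. v y \<partial>\<nu>) + e"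
    using e' by (simp add: distrib_left)
  finally show "(W2 (distr \<mu> borel f) (distr \<nu> borel g))\<^sup>2
      \<le> k * (W2 \<mu> \<nu>)\<^sup>2 + (\<integral>x. u x \<partial>\<mu>) + (\<integral>y. v y \<partial>\<nu>) + e" .
qed

text \<open>When the square of \<open>x - y + (a - b)\<close> is expanded, the cross term is linear
  in \<open>x - y\<close>. It splits into functions of \<open>x\<close> and of \<open>y\<close>,
  whose integrals are given by the means.\<close>

lemma W2_translate_le:
  fixes \<mu> \<nu> :: "'a::euclidean_space measure"
  assumes "\<mu> \<in> P2" "\<nu> \<in> P2"
  shows "(W2 (translate a \<mu>) (translate b \<nu>))\<^sup>2
    \<le> (W2 \<mu> \<nu>)\<^sup>2 + 2 * ((a - b) \<bullet> (mean \<mu> - mean \<nu>)) + (norm (a - b))\<^sup>2"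
proof -
  interpret \<mu>: prob_space \<mu> by (rule P2D(1)[OF assms(1)])
  note int = integrable_P2_id[OF assms(1)] integrable_P2_id[OF assms(2)]
  have "(W2 (translate a \<mu>) (translate b \<nu>))\<^sup>2
    \<le> 1 * (W2 \<mu> \<nu>)\<^sup>2 + (\<integral>x. 2 * ((a - b) \<bullet> x) + (norm (a - b))\<^sup>2 \<partial>\<mu>) + (\<integral>y. - 2 * ((a - b) \<bullet> y) \<partial>\<nu>)"
    unfolding translate_def
  proof (rule W2_distr_le)
    show "integrable \<mu> (\<lambda>x. 2 * ((a - b) \<bullet> x) + (norm (a - b))\<^sup>2)" "integrable \<nu> (\<lambda>y. - 2 * ((a - b) \<bullet> y))"
      using int by auto
    show "(norm (x + a - (y + b)))\<^sup>2 = 1 * (norm (x - y))\<^sup>2 + (2 * ((a - b) \<bullet> x) + (norm (a - b))\<^sup>2) + - 2 * ((a - b) \<bullet> y)" for x y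
      by (simp add: power2_norm_eq_inner inner_diff_left inner_diff_right inner_add_left inner_add_right
          inner_commute algebra_simps)
  qed (use assms translate_P2[unfolded translate_def] in auto)
  then show ?thesis
    using int by (simp add: mean_def \<mu>.prob_space inner_diff_right)
qed

lemma W2_translate:
  fixes \<mu> \<nu> :: "'a::euclidean_space measure"
  assumes "\<mu> \<in> P2" "\<nu> \<in> P2"
  shows "(W2 (translate a \<mu>) (translate b \<nu>))\<^sup>2
    = (W2 \<mu> \<nu>)\<^sup>2 + 2 * ((a - b) \<bullet> (mean \<mu> - mean \<nu>)) + (norm (a - b))\<^sup>2"
proof (rule antisym)
  let ?\<mu> = "translate a \<mu>" and ?\<nu> = "translate b \<nu>"
  have "(W2 (translate (- a) ?\<mu>) (translate (- b) ?\<nu>))\<^sup>2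
    \<le> (W2 ?\<mu> ?\<nu>)\<^sup>2 + 2 * ((- a - - b) \<bullet> (mean ?\<mu> - mean ?\<nu>)) + (norm (- a - - b))\<^sup>2"
    by (intro W2_translate_le translate_P2 assms)
  moreover have "translate (- a) ?\<mu> = \<mu>" "translate (- b) ?\<nu> = \<nu>"
    using assms by (simp_all add: translate_translate translate_0)
  \<comment> \<open>The new means differ by the old difference plus \<open>a - b\<close>; hence the
    additional square.\<close>
  moreover have "(- a - - b) \<bullet> (mean ?\<mu> - mean ?\<nu>) = - ((a - b) \<bullet> (mean \<mu> - mean \<nu>)) - (norm (a - b))\<^sup>2"
    using assms by (simp add: mean_translate power2_norm_eq_inner algebra_simps inner_commute)
  moreover have "norm (- a - - b) = norm (a - b)"
    by (simp add: norm_minus_commute)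
  ultimately show "(W2 \<mu> \<nu>)\<^sup>2 + 2 * ((a - b) \<bullet> (mean \<mu> - mean \<nu>)) + (norm (a - b))\<^sup>2 \<le> (W2 ?\<mu> ?\<nu>)\<^sup>2"
    by simp
qed (rule W2_translate_le[OF assms])

text \<open>The squared distance of \<open>x\<close> and \<open>y\<close> enters with coefficient
  \<open>s * t\<close>, which is nonnegative as \<open>W2_distr_le\<close> demands; the rest depends
  on \<open>x\<close> or \<open>y\<close> alone. The bracket \<open>second_moment \<mu> +
  second_moment \<nu> - (W2 \<mu> \<nu>)\<^sup>2\<close> stands for twice an inner product, as in
  the polarization identity.\<close>

lemma W2_dilate_le:
  fixes \<mu> \<nu> :: "'a::euclidean_space measure"
  assumes "\<mu> \<in> P2" "\<nu> \<in> P2" "0 \<le> s" "0 \<le> t"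
  shows "(W2 (dilate s \<mu>) (dilate t \<nu>))\<^sup>2 \<le> s\<^sup>2 * second_moment \<mu> + t\<^sup>2 * second_moment \<nu>
    - s * t * (second_moment \<mu> + second_moment \<nu> - (W2 \<mu> \<nu>)\<^sup>2)"
proof -
  have "(W2 (dilate s \<mu>) (dilate t \<nu>))\<^sup>2 \<le> (s * t) * (W2 \<mu> \<nu>)\<^sup>2
    + (\<integral>x. (s\<^sup>2 - s * t) * (norm x)\<^sup>2 \<partial>\<mu>) + (\<integral>y. (t\<^sup>2 - s * t) * (norm y)\<^sup>2 \<partial>\<nu>)"
    unfolding dilate_def
  proof (rule W2_distr_le)
    show "integrable \<mu> (\<lambda>x. (s\<^sup>2 - s * t) * (norm x)\<^sup>2)" "integrable \<nu> (\<lambda>y. (t\<^sup>2 - s * t) * (norm y)\<^sup>2)"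
      using P2D(3)[OF assms(1)] P2D(3)[OF assms(2)] by auto
    show "(norm (s *\<^sub>R x - t *\<^sub>R y))\<^sup>2 = s * t * (norm (x - y))\<^sup>2 + (s\<^sup>2 - s * t) * (norm x)\<^sup>2 + (t\<^sup>2 - s * t) * (norm y)\<^sup>2" for x y :: 'a
      unfolding power2_norm_eq_inner
      by (simp add: inner_diff_left inner_diff_right inner_commute power2_eq_square algebra_simps)
  qed (use assms dilate_P2[unfolded dilate_def] in auto)
  also have "\<dots> = (s * t) * (W2 \<mu> \<nu>)\<^sup>2 + (s\<^sup>2 - s * t) * second_moment \<mu> + (t\<^sup>2 - s * t) * second_moment \<nu>"
    by (simp add: second_moment_def)
  finally show ?thesis
    by (simp add: algebra_simps)
qed

text \<open>The inverse dilations by \<open>1 / s\<close> and \<open>1 / t\<close> give the reverse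
  bound after multiplication by \<open>s * t\<close>; both factors have to be positive for
  this.\<close>

lemma W2_dilate_pos:
  fixes \<mu> \<nu> :: "'a::euclidean_space measure"
  assumes "\<mu> \<in> P2" "\<nu> \<in> P2" "0 < s" "0 < t"
  shows "(W2 (dilate s \<mu>) (dilate t \<nu>))\<^sup>2 = s\<^sup>2 * second_moment \<mu> + t\<^sup>2 * second_moment \<nu>
    - s * t * (second_moment \<mu> + second_moment \<nu> - (W2 \<mu> \<nu>)\<^sup>2)"
proof (rule antisym)
  let ?\<mu> = "dilate s \<mu>" and ?\<nu> = "dilate t \<nu>"
  let ?m = "second_moment \<mu>" and ?n = "second_moment \<nu>"
  have "(W2 (dilate (1 / s) ?\<mu>) (dilate (1 / t) ?\<nu>))\<^sup>2
      \<le> (1 / s)\<^sup>2 * second_moment ?\<mu> + (1 / t)\<^sup>2 * second_moment ?\<nu>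
        - (1 / s) * (1 / t) * (second_moment ?\<mu> + second_moment ?\<nu> - (W2 ?\<mu> ?\<nu>)\<^sup>2)"
    using assms by (intro W2_dilate_le dilate_P2) auto
  moreover have "dilate (1 / s) ?\<mu> = \<mu>" "dilate (1 / t) ?\<nu> = \<nu>"
    using assms by (simp_all add: dilate_dilate dilate_1)
  ultimately have "(W2 \<mu> \<nu>)\<^sup>2 \<le> ?m + ?n - (s\<^sup>2 * ?m + t\<^sup>2 * ?n - (W2 ?\<mu> ?\<nu>)\<^sup>2) / (s * t)"
    using assms by (simp add: second_moment_dilate power_divide)
  then have "(W2 \<mu> \<nu>)\<^sup>2 * (s * t) \<le> (?m + ?n - (s\<^sup>2 * ?m + t\<^sup>2 * ?n - (W2 ?\<mu> ?\<nu>)\<^sup>2) / (s * t)) * (s * t)"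
    using assms by (intro mult_right_mono) auto
  also have "\<dots> = (?m + ?n) * (s * t) - (s\<^sup>2 * ?m + t\<^sup>2 * ?n - (W2 ?\<mu> ?\<nu>)\<^sup>2)"
    using assms by (subst left_diff_distrib) simp
  finally show "s\<^sup>2 * ?m + t\<^sup>2 * ?n - s * t * (?m + ?n - (W2 \<mu> \<nu>)\<^sup>2) \<le> (W2 ?\<mu> ?\<nu>)\<^sup>2"
    by (simp add: algebra_simps)
qed (use W2_dilate_le[OF assms(1,2)] assms in simp)

lemma return_P2: "return borel (a :: 'a::euclidean_space) \<in> P2"
  by (intro P2I) (auto intro: prob_space_return simp: nn_integral_return)

lemma dilate_0: "dilate 0 \<mu> = return borel 0" if "\<mu> \<in> P2" for \<mu> :: "'a::euclidean_space measure"
  using prob_space.distr_const[OF P2D(1)[OF that], of "0 :: 'a" borel] by (simp add: dilate_def)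

text \<open>In every coupling the first coordinate is 0 almost surely, so all couplings have the
  same cost. The Dirac measure at 0 will be the vertex of the cone, and the root of the second
  moment the radius.\<close>

lemma W2_return_0: "(W2 (return borel 0) \<nu>)\<^sup>2 = second_moment \<nu>" if \<nu>: "\<nu> \<in> P2"
  for \<nu> :: "'a::euclidean_space measure"
proof (rule antisym)
  have cost: "(\<integral>p. (norm (fst p - snd p))\<^sup>2 \<partial>\<pi>) = second_moment \<nu>"
    if \<pi>: "\<pi> \<in> couplings (return borel 0) \<nu>" for \<pi>
  proof -
    note \<pi>D = couplingsD[OF \<pi>]
    note [measurable_cong] = \<pi>D(2)
    have "AE x in return borel (0 :: 'a). x = 0"
      by (simp add: AE_return)
    then have "AE p in \<pi>. fst p = 0"
      by (subst (asm) \<pi>D(3)[symmetric], subst (asm) AE_distr_iff) auto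
    then have "(\<integral>p. (norm (fst p - snd p))\<^sup>2 \<partial>\<pi>) = (\<integral>p. (norm (snd p))\<^sup>2 \<partial>\<pi>)"
      by (intro integral_cong_AE) auto
    also have "\<dots> = second_moment \<nu>"
      using integral_coupling(4)[OF return_P2 \<nu> \<pi> P2D(3)[OF return_P2] P2D(3)[OF \<nu>]]
      by (simp add: second_moment_def)
    finally show ?thesis .
  qed
  show "second_moment \<nu> \<le> (W2 (return borel 0) \<nu>)\<^sup>2"
  proof (rule field_le_epsilon)
    fix e :: real assume "0 < e"
    then obtain \<pi> where "\<pi> \<in> couplings (return borel 0) \<nu>"
      "(\<integral>p. (norm (fst p - snd p))\<^sup>2 \<partial>\<pi>) \<le> (W2 (return borel 0) \<nu>)\<^sup>2 + e"
      by (rule W2_square_approx[OF return_P2 \<nu>])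
    then show "second_moment \<nu> \<le> (W2 (return borel 0) \<nu>)\<^sup>2 + e"
      using cost by simp
  qed
  have c: "return borel 0 \<Otimes>\<^sub>M \<nu> \<in> couplings (return borel 0) \<nu>"
    using P2D[OF \<nu>] P2D[OF return_P2] by (intro pair_measure_coupling) auto
  show "(W2 (return borel 0) \<nu>)\<^sup>2 \<le> second_moment \<nu>"
    using W2_square_le_cost[OF return_P2 \<nu> c] cost[OF c] by simp
qed

text \<open>Dilation by 0 is not invertible, but its result is the Dirac measure at 0, from which
  the distance is known.\<close>

lemma W2_dilate:
  fixes \<mu> \<nu> :: "'a::euclidean_space measure"
  assumes "\<mu> \<in> P2" "\<nu> \<in> P2" "0 \<le> s" "0 \<le> t"
  shows "(W2 (dilate s \<mu>) (dilate t \<nu>))\<^sup>2 = s\<^sup>2 * second_moment \<mu> + t\<^sup>2 * second_moment \<nu>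
    - s * t * (second_moment \<mu> + second_moment \<nu> - (W2 \<mu> \<nu>)\<^sup>2)"
proof -
  consider "0 < s" "0 < t" | "s = 0" | "t = 0"
    using assms by linarith
  then show ?thesis
  proof cases
    case 1
    then show ?thesis by (rule W2_dilate_pos[OF assms(1,2)])
  next
    case 2
    then show ?thesis
      using assms by (simp add: dilate_0 W2_return_0 dilate_P2 second_moment_dilate)
  next
    case 3
    then show ?thesis
      using assms by (simp add: dilate_0 W2_return_0 dilate_P2 second_moment_dilate W2_commute[of _ "return borel 0"])
  qed
qed

section \<open>Cone structure\<close>

text \<open>In the plane take points at distances \<open>sin \<beta>\<close>, \<open>sin (\<alpha> + \<beta>) / 2\<close>, \<open>sin \<alpha>\<close> from the origin on three
  rays with consecutive angles \<open>\<alpha>\<close> and \<open>\<beta>\<close>: the second is the midpoint of the other two, so that the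
  triangle inequality, applied to these radii, compares \<open>\<gamma>\<close> with \<open>\<alpha> + \<beta>\<close>.\<close>

lemma cos_add_le_of_unit_chords:
  fixes \<alpha> \<beta> \<gamma> p q w :: real
  assumes "0 < \<alpha>" "0 < \<beta>" "\<alpha> + \<beta> < pi"
    and chord: "\<And>r s t :: real. 0 < r \<Longrightarrow> 0 < s \<Longrightarrow> 0 < t \<Longrightarrow>
      sqrt (s\<^sup>2 + t\<^sup>2 - 2 * s * t * cos \<gamma>) \<le>
        sqrt (s\<^sup>2 + r\<^sup>2 - 2 * s * r * cos \<alpha>) + sqrt (r\<^sup>2 + t\<^sup>2 - 2 * r * t * cos \<beta>)"
  shows "cos (\<alpha> + \<beta>) \<le> cos \<gamma>"
proof -
  define A a B b where ab: "A = sin \<alpha>" "a = cos \<alpha>" "B = sin \<beta>" "b = cos \<beta>"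
  have pos: "0 < A" "0 < B"
    using assms(1-3) by (auto simp: ab intro!: sin_gt_zero)
  have a2: "a\<^sup>2 = 1 - A\<^sup>2" and b2: "b\<^sup>2 = 1 - B\<^sup>2"
    by (simp_all add: ab cos_squared_eq)
  define r where "r = (A * b + a * B) / 2"
  have "0 < sin (\<alpha> + \<beta>)"
    using assms by (intro sin_gt_zero) auto
  then have r: "0 < r"
    by (simp add: r_def ab sin_add)
  \<comment> \<open>The squared distance of the two outer points; the midpoint has squared distance
    \<open>D / 4\<close> from each.\<close>
  define D where "D = (A * b - a * B)\<^sup>2 + 4 * A\<^sup>2 * B\<^sup>2"
  have "0 \<le> D"
    by (simp add: D_def)
  have 1: "B\<^sup>2 + r\<^sup>2 - 2 * B * r * a = D / 4"
  proof -
    have "B\<^sup>2 + r\<^sup>2 - 2 * B * r * a - D / 4 = B\<^sup>2 * (1 - A\<^sup>2 - a\<^sup>2)"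
      by (simp add: r_def D_def field_simps power2_eq_square)
    then show ?thesis by (simp add: a2)
  qed
  have 2: "r\<^sup>2 + A\<^sup>2 - 2 * r * A * b = D / 4"
  proof -
    have "r\<^sup>2 + A\<^sup>2 - 2 * r * A * b - D / 4 = A\<^sup>2 * (1 - B\<^sup>2 - b\<^sup>2)"
      by (simp add: r_def D_def field_simps power2_eq_square)
    then show ?thesis by (simp add: b2)
  qed
  have "sqrt (B\<^sup>2 + A\<^sup>2 - 2 * B * A * cos \<gamma>)
      \<le> sqrt (B\<^sup>2 + r\<^sup>2 - 2 * B * r * a) + sqrt (r\<^sup>2 + A\<^sup>2 - 2 * r * A * b)"
    unfolding ab(2,4) by (rule chord[OF r pos(2,1)])
  also have "\<dots> = sqrt (D / 4) + sqrt (D / 4)"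
    by (simp only: 1 2)
  also have "\<dots> = sqrt D"
    by (simp add: real_sqrt_divide)
  finally have "B\<^sup>2 + A\<^sup>2 - 2 * B * A * cos \<gamma> \<le> D"
    by simp
  also have "D = A\<^sup>2 * b\<^sup>2 + a\<^sup>2 * B\<^sup>2 - 2 * A * B * a * b + 4 * A\<^sup>2 * B\<^sup>2"
    by (simp add: D_def field_simps power2_eq_square)
  also have "\<dots> = A\<^sup>2 * (1 - B\<^sup>2) + (1 - A\<^sup>2) * B\<^sup>2 - 2 * A * B * a * b + 4 * A\<^sup>2 * B\<^sup>2"
    by (simp only: a2 b2)
  also have "\<dots> = B\<^sup>2 + A\<^sup>2 - 2 * B * A * (a * b - A * B)"
    by (simp add: field_simps power2_eq_square)
  finally have "(B * A) * (a * b - A * B) \<le> (B * A) * cos \<gamma>"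
    by (simp add: mult.assoc)
  then have "a * b - A * B \<le> cos \<gamma>"
    using pos by (simp del: mult.assoc)
  then show ?thesis
    by (simp add: cos_add ab)
qed

section \<open>The unit sphere, its angle metric, and the cone over it\<close>

definition unit_sphere :: "'a::euclidean_space measure set" where
  "unit_sphere = {\<mu> \<in> P2. second_moment \<mu> = 1}"

text \<open>The central angle of a chord of length \<open>W2 \<mu> \<nu>\<close> in a unit circle.
  The value 0 off the sphere serves \<open>Metric_space\<close>, which asks for nonnegativity on the
  whole type.\<close>

definition angle :: "'a::euclidean_space measure \<Rightarrow> 'a measure \<Rightarrow> real" where
  "angle \<mu> \<nu> = (if \<mu> \<in> unit_sphere \<and> \<nu> \<in> unit_sphere then arccos (1 - (W2 \<mu> \<nu>)\<^sup>2 / 2) else 0)"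

lemma unit_sphereD: "\<mu> \<in> P2" "second_moment \<mu> = 1" if "\<mu> \<in> unit_sphere"
  using that by (auto simp: unit_sphere_def)

text \<open>Both measures have distance 1 from the Dirac measure at 0. The bound puts the argument
  of \<open>arccos\<close> between -1 and 1.\<close>

lemma W2_unit_sphere_le:
  fixes \<mu> \<nu> :: "'a::euclidean_space measure"
  assumes "\<mu> \<in> unit_sphere" "\<nu> \<in> unit_sphere"
  shows "W2 \<mu> \<nu> \<le> 2"
proof -
  have norm1: "W2 (return borel 0) \<rho> = 1" if "\<rho> \<in> unit_sphere" for \<rho> :: "'a measure"
    using W2_return_0[of \<rho>] unit_sphereD[OF that] W2_nonneg[of "return borel 0" \<rho>]
    by (simp add: power2_eq_1_iff)
  have "W2 \<mu> \<nu> \<le> W2 \<mu> (return borel 0) + W2 (return borel 0) \<nu>"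
    using assms by (intro W2_triangle return_P2) (auto dest: unit_sphereD)
  then show ?thesis
    using norm1[OF assms(1)] norm1[OF assms(2)] by (simp add: W2_commute[of \<mu>])
qed

lemma cos_angle:
  assumes "\<mu> \<in> unit_sphere" "\<nu> \<in> unit_sphere"
  shows "cos (angle \<mu> \<nu>) = 1 - (W2 \<mu> \<nu>)\<^sup>2 / 2" "0 \<le> angle \<mu> \<nu>" "angle \<mu> \<nu> \<le> pi"
proof -
  have "(W2 \<mu> \<nu>)\<^sup>2 \<le> 2\<^sup>2"
    using assms by (intro power_mono W2_unit_sphere_le W2_nonneg)
  then have "- 1 \<le> 1 - (W2 \<mu> \<nu>)\<^sup>2 / 2" "1 - (W2 \<mu> \<nu>)\<^sup>2 / 2 \<le> 1"
    by simp_all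
  then show "cos (angle \<mu> \<nu>) = 1 - (W2 \<mu> \<nu>)\<^sup>2 / 2" "0 \<le> angle \<mu> \<nu>" "angle \<mu> \<nu> \<le> pi"
    using assms by (auto simp: angle_def intro: arccos_lbound arccos_ubound)
qed

lemma W2_dilate_unit_sphere:
  fixes \<mu> \<nu> :: "'a::euclidean_space measure"
  assumes "\<mu> \<in> unit_sphere" "\<nu> \<in> unit_sphere" "0 \<le> s" "0 \<le> t"
  shows "W2 (dilate s \<mu>) (dilate t \<nu>) = sqrt (s\<^sup>2 + t\<^sup>2 - 2 * s * t * cos (angle \<mu> \<nu>))"
proof -
  have "(W2 (dilate s \<mu>) (dilate t \<nu>))\<^sup>2 = s\<^sup>2 + t\<^sup>2 - 2 * s * t * cos (angle \<mu> \<nu>)"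
    using assms W2_dilate[of \<mu> \<nu> s t] by (simp add: unit_sphereD cos_angle field_simps)
  then show ?thesis
    by (metis W2_nonneg abs_of_nonneg real_sqrt_abs)
qed

lemma angle_eq_0_iff:
  assumes "\<mu> \<in> unit_sphere" "\<nu> \<in> unit_sphere"
  shows "angle \<mu> \<nu> = 0 \<longleftrightarrow> \<mu> = \<nu>"
proof
  assume "angle \<mu> \<nu> = 0"
  then have "W2 \<mu> \<nu> = 0"
    using cos_angle(1)[OF assms] by simp
  then show "\<mu> = \<nu>"
    using assms by (intro W2_eq_0_imp_eq) (auto dest: unit_sphereD)
next
  assume "\<mu> = \<nu>"
  then have "W2 \<mu> \<nu> = 0"
    using assms by (auto intro: W2_self dest: unit_sphereD)
  then show "angle \<mu> \<nu> = 0"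
    using assms by (simp add: angle_def)
qed

text \<open>If a summand is 0, two of the measures coincide; a sum of at least \<open>pi\<close>
  exceeds every angle or equals the largest. Otherwise the triangle inequality of \<open>W2\<close>
  for dilates is the chord hypothesis of \<open>cos_add_le_of_unit_chords\<close>, and the cosine is
  decreasing.\<close>

lemma angle_triangle:
  fixes \<mu> \<nu> \<rho> :: "'a::euclidean_space measure"
  assumes "\<mu> \<in> unit_sphere" "\<nu> \<in> unit_sphere" "\<rho> \<in> unit_sphere"
  shows "angle \<mu> \<rho> \<le> angle \<mu> \<nu> + angle \<nu> \<rho>"
proof -
  consider "angle \<mu> \<nu> = 0" | "angle \<nu> \<rho> = 0" | "pi \<le> angle \<mu> \<nu> + angle \<nu> \<rho>"
    | "0 < angle \<mu> \<nu>" "0 < angle \<nu> \<rho>" "angle \<mu> \<nu> + angle \<nu> \<rho> < pi"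
    using cos_angle(2)[OF assms(1,2)] cos_angle(2)[OF assms(2,3)] by linarith
  then show ?thesis
  proof cases
    case 1
    then show ?thesis
      using assms cos_angle(2) by (simp add: angle_eq_0_iff)
  next
    case 2
    then show ?thesis
      using assms cos_angle(2) by (simp add: angle_eq_0_iff)
  next
    case 3
    then show ?thesis
      using cos_angle(3)[OF assms(1,3)] by linarith
  next
    case 4
    have "cos (angle \<mu> \<nu> + angle \<nu> \<rho>) \<le> cos (angle \<mu> \<rho>)"
    proof (rule cos_add_le_of_unit_chords[OF 4])
      fix r s t :: real
      assume "0 < r" "0 < s" "0 < t"
      moreover have "W2 (dilate s \<mu>) (dilate t \<rho>) \<le> W2 (dilate s \<mu>) (dilate r \<nu>) + W2 (dilate r \<nu>) (dilate t \<rho>)"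
        using assms by (intro W2_triangle dilate_P2) (auto dest: unit_sphereD)
      ultimately show "sqrt (s\<^sup>2 + t\<^sup>2 - 2 * s * t * cos (angle \<mu> \<rho>)) \<le>
          sqrt (s\<^sup>2 + r\<^sup>2 - 2 * s * r * cos (angle \<mu> \<nu>)) + sqrt (r\<^sup>2 + t\<^sup>2 - 2 * r * t * cos (angle \<nu> \<rho>))"
        using assms by (simp add: W2_dilate_unit_sphere)
    qed
    then show ?thesis
      using 4 cos_angle(3)[OF assms(1,3)] cos_monotone_0_pi[of "angle \<mu> \<nu> + angle \<nu> \<rho>" "angle \<mu> \<rho>"]
      by linarith
  qed
qed

lemma Metric_space_unit_sphere: "Metric_space (unit_sphere :: 'a::euclidean_space measure set) angle"
proof
  show "0 \<le> angle \<mu> \<nu>" for \<mu> \<nu> :: "'a measure"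
    using cos_angle(2)[of \<mu> \<nu>] by (cases "\<mu> \<in> unit_sphere \<and> \<nu> \<in> unit_sphere") (auto simp: angle_def)
  show "angle \<mu> \<nu> = angle \<nu> \<mu>" for \<mu> \<nu> :: "'a measure"
    by (auto simp: angle_def W2_commute)
qed (auto intro: angle_triangle simp: angle_eq_0_iff)

text \<open>The cone over the empty set is empty, without a vertex to receive the Dirac measure at
  0.\<close>

lemma ex_unit_sphere: "\<exists>\<mu>. \<mu> \<in> (unit_sphere :: 'a::euclidean_space measure set)"
proof -
  obtain e :: 'a where "e \<in> Basis"
    using nonempty_Basis by blast
  then have "return borel e \<in> unit_sphere"
    using return_P2[of e] by (simp add: unit_sphere_def second_moment_def integral_return)
  then show ?thesis ..
qed

lemma has_cone_structure_P2: "has_cone_structure (P2 :: 'a::euclidean_space measure set) W2"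
proof -
  let ?\<Sigma> = "unit_sphere :: 'a measure set"
  obtain \<xi> :: "'a measure" where \<xi>: "\<xi> \<in> ?\<Sigma>"
    using ex_unit_sphere by blast
  \<comment> \<open>Direction and radius. The Dirac measure at 0 has no direction of its own; \<xi>
    is an arbitrary one, forgotten by the cone class.\<close>
  define \<phi> where "\<phi> \<mu> = (if second_moment \<mu> = 0 then (\<xi>, 0)
    else (dilate (1 / sqrt (second_moment \<mu>)) \<mu>, sqrt (second_moment \<mu>)))" for \<mu> :: "'a measure"
  have \<phi>: "\<phi> \<mu> \<in> ?\<Sigma> \<times> {0..}" "dilate (snd (\<phi> \<mu>)) (fst (\<phi> \<mu>)) = \<mu>" if "\<mu> \<in> P2" for \<mu>
  proof -
    show "\<phi> \<mu> \<in> ?\<Sigma> \<times> {0..}"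
      using that \<xi> second_moment_nonneg[of \<mu>]
      by (auto simp: \<phi>_def unit_sphere_def dilate_P2 second_moment_dilate power_divide)
    show "dilate (snd (\<phi> \<mu>)) (fst (\<phi> \<mu>)) = \<mu>"
    proof (cases "second_moment \<mu> = 0")
      case True
      then have "W2 (return borel 0) \<mu> = 0"
        using W2_return_0[OF that] by simp
      then have "return borel 0 = \<mu>"
        by (rule W2_eq_0_imp_eq[OF return_P2 that])
      then show ?thesis
        using True \<xi> by (simp add: \<phi>_def dilate_0 unit_sphereD)
    next
      case False
      then show ?thesis
        using that by (simp add: \<phi>_def dilate_dilate dilate_1)
    qed
  qed
  define f where "f \<mu> = cone_rel ?\<Sigma> `` {\<phi> \<mu>}" for \<mu>
  \<comment> \<open>The bound of \<open>angle\<close> by \<open>pi\<close> resolves the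
    \<open>min\<close> in \<open>cone_predist\<close>.\<close>
  have predist: "cone_predist angle p q = W2 (dilate (snd p) (fst p)) (dilate (snd q) (fst q))"
    if "p \<in> ?\<Sigma> \<times> {0..}" "q \<in> ?\<Sigma> \<times> {0..}" for p q
    using that cos_angle(3)[of "fst p" "fst q"]
    by (auto simp: cone_predist_def W2_dilate_unit_sphere min_absorb1 split: prod.splits)
  have dist: "cone_dist angle (f \<mu>) (f \<nu>) = W2 \<mu> \<nu>" if "\<mu> \<in> P2" "\<nu> \<in> P2" for \<mu> \<nu>
    using \<phi>[OF that(1)] \<phi>[OF that(2)] by (simp add: f_def cone_dist_class predist)
  have "inj_on f P2"
  proof (rule inj_onI)
    fix \<mu> \<nu> assume P2: "\<mu> \<in> P2" "\<nu> \<in> P2" and "f \<mu> = f \<nu>"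
    then have "W2 \<mu> \<nu> = W2 \<nu> \<nu>"
      using dist[OF P2] dist[OF P2(2) P2(2)] by simp
    then show "\<mu> = \<nu>"
      using W2_eq_0_imp_eq[OF P2] W2_self[OF P2(2)] by simp
  qed
  moreover have "f ` P2 = cone ?\<Sigma>"
  proof
    show "f ` P2 \<subseteq> cone ?\<Sigma>"
      using \<phi>(1) by (auto simp: f_def cone_def intro!: quotientI)
    show "cone ?\<Sigma> \<subseteq> f ` P2"
    proof
      fix c assume "c \<in> cone ?\<Sigma>"
      then obtain \<mu> s where \<mu>: "\<mu> \<in> ?\<Sigma>" "0 \<le> s" and c: "c = cone_rel ?\<Sigma> `` {(\<mu>, s)}"
        by (auto simp: cone_def elim!: quotientE)
      have m: "second_moment (dilate s \<mu>) = s\<^sup>2"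
        using \<mu> by (simp add: second_moment_dilate unit_sphereD)
      \<comment> \<open>For \<open>s > 0\<close> the two pairs are equal; for \<open>s = 0\<close>
        they may differ in direction, but both have radius 0.\<close>
      have "((\<mu>, s), \<phi> (dilate s \<mu>)) \<in> cone_rel ?\<Sigma>"
        using \<mu> \<xi> m by (auto simp: cone_rel_def \<phi>_def dilate_dilate dilate_1 unit_sphereD)
      then have "c = f (dilate s \<mu>)"
        unfolding c f_def by (rule equiv_class_eq[OF equiv_cone_rel])
      then show "c \<in> f ` P2"
        using \<mu> dilate_P2 unit_sphereD(1) by blast
    qed
  qed
  ultimately have "isometric (P2 :: 'a measure set) W2 (cone ?\<Sigma>) (cone_dist angle)"
    unfolding isometric_def isometric_embedding_def bij_betw_def
    using dist by - (rule exI[of _ f], simp)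
  then show ?thesis
    using Metric_space_unit_sphere by (auto simp: has_cone_structure_def)
qed

section \<open>Splitting off the mean\<close>

definition centered_P2 :: "'a::euclidean_space measure set" where
  "centered_P2 = {\<mu> \<in> P2. mean \<mu> = 0}"

lemma centered_P2D: "\<mu> \<in> P2" "mean \<mu> = 0" if "\<mu> \<in> centered_P2"
  using that by (auto simp: centered_P2_def)

text \<open>Translating by minus the means contributes -2 times the squared distance of the means
  from the cross term and +1 times it from the square: in total it is subtracted once.\<close>

lemma W2_center:
  assumes "\<mu> \<in> P2" "\<nu> \<in> P2"
  shows "(W2 \<mu> \<nu>)\<^sup>2 = (dist (mean \<mu>) (mean \<nu>))\<^sup>2
    + (W2 (translate (- mean \<mu>) \<mu>) (translate (- mean \<nu>) \<nu>))\<^sup>2"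
proof -
  have "- mean \<mu> - - mean \<nu> = - (mean \<mu> - mean \<nu>)"
    by simp
  then show ?thesis
    by (simp only: W2_translate[OF assms] inner_minus_left norm_minus_cancel)
      (simp add: dist_norm power2_norm_eq_inner)
qed

lemma center_centered_P2: "translate (- mean \<mu>) \<mu> \<in> centered_P2" if "\<mu> \<in> P2"
  using that by (simp add: centered_P2_def translate_P2 mean_translate)

text \<open>The mean is 1-Lipschitz, so limits of centered measures are centered.\<close>

lemma dist_mean_le_W2: "dist (mean \<mu>) (mean \<nu>) \<le> W2 \<mu> \<nu>" if "\<mu> \<in> P2" "\<nu> \<in> P2"
  using W2_center[OF that] by (intro power2_le_imp_le[OF _ W2_nonneg]) simp

lemma W2_center_le: "W2 (translate (- mean \<mu>) \<mu>) (translate (- mean \<nu>) \<nu>) \<le> W2 \<mu> \<nu>"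
  if "\<mu> \<in> P2" "\<nu> \<in> P2"
  using W2_center[OF that] by (intro power2_le_imp_le[OF _ W2_nonneg]) simp

lemma isometric_P2_product:
  "isometric (P2 :: 'a::euclidean_space measure set) W2
    ((UNIV :: 'a set) \<times> (centered_P2 :: 'a measure set)) (prod_dist dist W2)"
proof -
  define f where "f \<mu> = (mean \<mu>, translate (- mean \<mu>) \<mu>)" for \<mu> :: "'a measure"
  have "bij_betw f P2 (UNIV \<times> centered_P2)"
  proof (rule bij_betw_byWitness[where f'="\<lambda>(a, \<mu>). translate a \<mu>"])
    show "\<forall>\<mu>\<in>P2. (\<lambda>(a, \<mu>). translate a \<mu>) (f \<mu>) = \<mu>"
      by (simp add: f_def translate_translate translate_0)
    show "\<forall>p\<in>UNIV \<times> centered_P2. f ((\<lambda>(a, \<mu>). translate a \<mu>) p) = p"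
      by (auto simp: f_def centered_P2_def mean_translate translate_translate translate_0)
    show "f ` P2 \<subseteq> UNIV \<times> centered_P2"
      using center_centered_P2 by (auto simp: f_def)
    show "(\<lambda>(a, \<mu>). translate a \<mu>) ` (UNIV \<times> centered_P2) \<subseteq> P2"
      by (auto simp: centered_P2_def translate_P2)
  qed
  moreover have "prod_dist dist W2 (f \<mu>) (f \<nu>) = W2 \<mu> \<nu>" if "\<mu> \<in> P2" "\<nu> \<in> P2" for \<mu> \<nu>
    using W2_center[OF that] W2_nonneg[of \<mu> \<nu>] unfolding prod_dist_def f_def
    by (simp flip: W2_center[OF that])
  ultimately show ?thesis
    unfolding isometric_def isometric_embedding_def bij_betw_def by - (rule exI[of _ f], simp)
qed

text \<open>The product coupling of centered measures has vanishing correlation, so no angle at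
  \<open>\<delta>\<^sub>0\<close> between them is obtuse.\<close>

lemma W2_centered_le:
  fixes \<mu> \<nu> :: "'a::euclidean_space measure"
  assumes "\<mu> \<in> centered_P2" "\<nu> \<in> centered_P2"
  shows "(W2 \<mu> \<nu>)\<^sup>2 \<le> second_moment \<mu> + second_moment \<nu>"
proof -
  note P2 = centered_P2D(1)[OF assms(1)] centered_P2D(1)[OF assms(2)]
  interpret \<mu>: prob_space \<mu> by (rule P2D(1)[OF P2(1)])
  interpret \<nu>: prob_space \<nu> by (rule P2D(1)[OF P2(2)])
  interpret pair_prob_space \<mu> \<nu> ..
  have \<pi>: "\<mu> \<Otimes>\<^sub>M \<nu> \<in> couplings \<mu> \<nu>"
    using P2D[OF P2(1)] P2D[OF P2(2)] by (intro pair_measure_coupling) auto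
  note int = integral_coupling[OF P2 \<pi> P2D(3)[OF P2(1)] P2D(3)[OF P2(2)]]
  have int_cost: "integrable (\<mu> \<Otimes>\<^sub>M \<nu>) (\<lambda>p. (norm (fst p - snd p))\<^sup>2)"
    by (rule integral_cost(1)[OF P2 \<pi>])
  \<comment> \<open>Polarization reduces integrability of the inner product, required for Fubini, to
    that of the squares.\<close>
  have inner: "fst p \<bullet> snd p = ((norm (fst p))\<^sup>2 + (norm (snd p))\<^sup>2 - (norm (fst p - snd p))\<^sup>2) / 2" for p :: "'a \<times> 'a"
    by (simp add: power2_norm_eq_inner inner_diff_left inner_diff_right inner_commute)
  have int_inner: "integrable (\<mu> \<Otimes>\<^sub>M \<nu>) (\<lambda>p. fst p \<bullet> snd p)"
    unfolding inner using int int_cost by auto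
  have "(\<integral>p. fst p \<bullet> snd p \<partial>(\<mu> \<Otimes>\<^sub>M \<nu>)) = (\<integral>x. (\<integral>y. x \<bullet> y \<partial>\<nu>) \<partial>\<mu>)"
    using integral_fst'[OF int_inner] by simp
  also have "\<dots> = 0"
    using integrable_P2_id[OF P2(2)] centered_P2D(2)[OF assms(2)] by (simp add: mean_def)
  finally have zero: "(\<integral>p. fst p \<bullet> snd p \<partial>(\<mu> \<Otimes>\<^sub>M \<nu>)) = 0" .
  have "(W2 \<mu> \<nu>)\<^sup>2 \<le> (\<integral>p. (norm (fst p - snd p))\<^sup>2 \<partial>(\<mu> \<Otimes>\<^sub>M \<nu>))"
    by (rule W2_square_le_cost[OF P2 \<pi>])
  also have "\<dots> = (\<integral>p. (norm (fst p))\<^sup>2 + (norm (snd p))\<^sup>2 - 2 * (fst p \<bullet> snd p) \<partial>(\<mu> \<Otimes>\<^sub>M \<nu>))"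
    by (intro Bochner_Integration.integral_cong refl)
      (simp add: power2_norm_eq_inner inner_diff_left inner_diff_right inner_commute)
  also have "\<dots> = second_moment \<mu> + second_moment \<nu>"
    using int int_inner zero by (simp add: second_moment_def)
  finally show ?thesis .
qed

section \<open>Lines and the rank\<close>

lemma no_line_centered_P2:
  fixes \<gamma> :: "real \<Rightarrow> 'a::euclidean_space measure"
  assumes \<gamma>: "\<And>t. \<gamma> t \<in> centered_P2" and iso: "\<And>s t. W2 (\<gamma> s) (\<gamma> t) = \<bar>s - t\<bar>"
  shows False
proof -
  define c where "c = W2 (return borel 0) (\<gamma> 0)"
  have c: "0 \<le> c"
    by (simp add: c_def W2_nonneg)
  have m: "second_moment (\<gamma> t) \<le> (c + \<bar>t\<bar>)\<^sup>2" for t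
  proof -
    have "W2 (return borel 0) (\<gamma> t) \<le> c + W2 (\<gamma> 0) (\<gamma> t)"
      unfolding c_def by (intro W2_triangle return_P2 centered_P2D(1)[OF \<gamma>])
    then have "W2 (return borel 0) (\<gamma> t) \<le> c + \<bar>t\<bar>"
      by (simp add: iso)
    then show ?thesis
      using W2_return_0[OF centered_P2D(1)[OF \<gamma>], of t] W2_nonneg by (metis power_mono)
  qed
  \<comment> \<open>Any \<open>t > 3 * c\<close> gives c + t < (4/3) t, and 16/9 < 2.\<close>
  define t where "t = 3 * c + 1"
  have t: "0 < t" using c by (simp add: t_def)
  have "(2 * t)\<^sup>2 = (W2 (\<gamma> t) (\<gamma> (- t)))\<^sup>2"
    by (simp add: iso)
  also have "\<dots> \<le> second_moment (\<gamma> t) + second_moment (\<gamma> (- t))"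
    by (rule W2_centered_le[OF \<gamma> \<gamma>])
  also have "\<dots> \<le> 2 * (c + t)\<^sup>2"
    using m[of t] m[of "- t"] t by simp
  finally have "2 * t\<^sup>2 \<le> (c + t)\<^sup>2"
    by (simp add: power_mult_distrib)
  moreover have "(c + t)\<^sup>2 < 2 * t\<^sup>2"
  proof -
    have "3 * (c + t) < 4 * t"
      by (simp add: t_def)
    then have "(3 * (c + t))\<^sup>2 < (4 * t)\<^sup>2"
      using c t by (intro power_strict_mono) auto
    then have "3\<^sup>2 * (c + t)\<^sup>2 < 4\<^sup>2 * t\<^sup>2"
      by (simp only: power_mult_distrib)
    then have "9 * (c + t)\<^sup>2 < 16 * t\<^sup>2"
      by simp
    then show ?thesis
      using zero_le_power2[of t] by linarith
  qed
  ultimately show False by simp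
qed

text \<open>For k > 0 the image of the first coordinate axis would be a line. Since 0 is the least
  \<open>enat\<close>, an upper bound on the supremum suffices.\<close>

lemma metric_rank_centered_P2: "metric_rank (centered_P2 :: 'a::euclidean_space measure set) W2 = 0"
proof -
  have "k = 0" if "isometric_embedding (topspace (Euclidean_space k)) (euclid_dist k) (centered_P2 :: 'a measure set) W2 f"
    for k and f :: "(nat \<Rightarrow> real) \<Rightarrow> 'a measure"
  proof (rule ccontr)
    assume "k \<noteq> 0"
    define e where "e t = (\<lambda>i::nat. if i = 0 then t else 0)" for t :: real
    have e: "e t \<in> topspace (Euclidean_space k)" for t
      using \<open>k \<noteq> 0\<close> by (simp add: e_def topspace_Euclidean_space)
    have "euclid_dist k (e s) (e t) = \<bar>s - t\<bar>" for s t
    proof -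
      have "(\<Sum>i<k. (e s i - e t i)\<^sup>2) = (\<Sum>i<k. if i = 0 then (s - t)\<^sup>2 else 0)"
        by (intro sum.cong) (auto simp: e_def)
      then show ?thesis
        using \<open>k \<noteq> 0\<close> by (simp add: euclid_dist_def)
    qed
    then show False
      using that e by (intro no_line_centered_P2[of "\<lambda>t. f (e t)"]) (auto simp: isometric_embedding_def)
  qed
  then have "{enat k |k. \<exists>f. isometric_embedding (topspace (Euclidean_space k)) (euclid_dist k) (centered_P2 :: 'a measure set) W2 f} \<subseteq> {0}"
    by (auto simp: zero_enat_def)
  then have "metric_rank (centered_P2 :: 'a measure set) W2 \<le> Sup {0}"
    unfolding metric_rank_def by (rule Sup_subset_mono)
  then show ?thesis
    by simp
qed

section \<open>Completeness and separability\<close>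

text \<open>Summable expected step lengths force almost sure convergence of the chain. Fatou's lemma
  carries the square bounds between its members over to the limit.\<close>

lemma W2_fast_Cauchy_converges:
  fixes \<mu> :: "nat \<Rightarrow> 'a::euclidean_space measure"
  assumes P2: "\<And>n. \<mu> n \<in> P2" and fast: "\<And>n. W2 (\<mu> n) (\<mu> (Suc n)) < (1 / 2) ^ n"
  obtains \<nu> where "\<nu> \<in> P2" "\<And>n. W2 (\<mu> n) \<nu> \<le> 2 * (1 / 2) ^ n"
proof -
  obtain \<Omega> :: "(nat \<Rightarrow> 'a) measure" and X :: "nat \<Rightarrow> (nat \<Rightarrow> 'a) \<Rightarrow> 'a" where \<Omega>: "prob_space \<Omega>"
    and X [measurable]: "\<And>n. X n \<in> borel_measurable \<Omega>" and law: "\<And>n. distr \<Omega> borel (X n) = \<mu> n"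
    and step: "\<And>n. (\<integral>\<^sup>+ \<omega>. ennreal ((norm (X n \<omega> - X (Suc n) \<omega>))\<^sup>2) \<partial>\<Omega>) \<le> ennreal (((1 / 2) ^ n)\<^sup>2)"
    using W2_chain[where \<mu>=\<mu> and c="\<lambda>n. (1 / 2) ^ n", OF P2 fast] by blast
  interpret prob_space \<Omega> by (fact \<Omega>)
  \<comment> \<open>Peeling off the first step reproduces the bound: (1/2)^n + 2 (1/2)^(n+1) = 2
    (1/2)^n.\<close>
  have far: "(\<integral>\<^sup>+ \<omega>. ennreal ((norm (X n \<omega> - X (n + k) \<omega>))\<^sup>2) \<partial>\<Omega>) \<le> ennreal ((2 * (1 / 2) ^ n)\<^sup>2)" for n k
  proof (induction k arbitrary: n)
    case (Suc k)
    have "(\<integral>\<^sup>+ \<omega>. ennreal ((norm (X n \<omega> - X (n + Suc k) \<omega>))\<^sup>2) \<partial>\<Omega>)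
        \<le> ennreal (((1 / 2) ^ n + 2 * (1 / 2) ^ Suc n)\<^sup>2)"
    proof (rule nn_integral_minkowski_dist[where Y="X (Suc n)"])
      show "(\<integral>\<^sup>+ \<omega>. ennreal ((norm (X (Suc n) \<omega> - X (n + Suc k) \<omega>))\<^sup>2) \<partial>\<Omega>) \<le> ennreal ((2 * (1 / 2) ^ Suc n)\<^sup>2)"
        using Suc.IH[of "Suc n"] by simp
    qed (use step in auto)
    then show ?case
      by simp
  qed simp
  have abs_step: "(\<integral>\<^sup>+ \<omega>. ennreal (norm (X n \<omega> - X (Suc n) \<omega>)) \<partial>\<Omega>) \<le> ennreal ((1 / 2) ^ n)" for n
  proof -
    define c :: real where "c = (1 / 2) ^ n"
    have c: "0 < c" by (simp add: c_def)
    \<comment> \<open>The inequality of means, tuned to equality at z = c, bounds the expected step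
      by the root of the square bound.\<close>
    have le: "z \<le> c / 2 + 1 / (2 * c) * z\<^sup>2" for z :: real
    proof -
      have "0 \<le> (z - c)\<^sup>2 / (2 * c)"
        using c by simp
      also have "\<dots> = c / 2 + 1 / (2 * c) * z\<^sup>2 - z"
        using c by (simp add: power2_eq_square field_simps)
      finally show ?thesis by simp
    qed
    have "(\<integral>\<^sup>+ \<omega>. ennreal (norm (X n \<omega> - X (Suc n) \<omega>)) \<partial>\<Omega>)
        \<le> (\<integral>\<^sup>+ \<omega>. ennreal (c / 2) + ennreal (1 / (2 * c)) * ennreal ((norm (X n \<omega> - X (Suc n) \<omega>))\<^sup>2) \<partial>\<Omega>)"
    proof (rule nn_integral_mono)
      fix \<omega>
      have "ennreal (norm (X n \<omega> - X (Suc n) \<omega>)) \<le> ennreal (c / 2 + 1 / (2 * c) * (norm (X n \<omega> - X (Suc n) \<omega>))\<^sup>2)"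
        by (intro ennreal_leI le)
      also have "\<dots> = ennreal (c / 2) + ennreal (1 / (2 * c)) * ennreal ((norm (X n \<omega> - X (Suc n) \<omega>))\<^sup>2)"
        using c by (subst ennreal_plus) (simp_all add: ennreal_mult[symmetric])
      finally show "ennreal (norm (X n \<omega> - X (Suc n) \<omega>)) \<le> \<dots>" .
    qed
    also have "\<dots> = ennreal (c / 2) + ennreal (1 / (2 * c)) * (\<integral>\<^sup>+ \<omega>. ennreal ((norm (X n \<omega> - X (Suc n) \<omega>))\<^sup>2) \<partial>\<Omega>)"
      by (simp add: nn_integral_add nn_integral_cmult emeasure_space_1)
    also have "\<dots> \<le> ennreal (c / 2) + ennreal (1 / (2 * c)) * ennreal (c\<^sup>2)"
      using step[of n] by (intro add_left_mono mult_left_mono) (auto simp: c_def)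
    also have "\<dots> = ennreal (c / 2 + 1 / (2 * c) * c\<^sup>2)"
      using c by (subst ennreal_plus) (simp_all add: ennreal_mult[symmetric])
    also have "c / 2 + 1 / (2 * c) * c\<^sup>2 = c"
      using c by (simp add: power2_eq_square)
    finally show ?thesis
      by (simp add: c_def)
  qed
  have "(\<integral>\<^sup>+ \<omega>. (\<Sum>n. ennreal (norm (X n \<omega> - X (Suc n) \<omega>))) \<partial>\<Omega>)
      = (\<Sum>n. \<integral>\<^sup>+ \<omega>. ennreal (norm (X n \<omega> - X (Suc n) \<omega>)) \<partial>\<Omega>)"
    by (rule nn_integral_suminf) measurable
  also have "\<dots> \<le> (\<Sum>n. ennreal ((1 / 2) ^ n))"
    by (intro suminf_le abs_step) auto
  also have "\<dots> < \<infinity>"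
  proof -
    have "summable (\<lambda>n. (1 / 2 :: real) ^ n)"
      by (rule summable_geometric) simp
    then have "(\<Sum>n. ennreal ((1 / 2) ^ n)) \<noteq> top"
      by (rule ennreal_suminf_neq_top) simp
    then show ?thesis
      by (simp only: infinity_ennreal_def less_top)
  qed
  finally have "AE \<omega> in \<Omega>. (\<Sum>n. ennreal (norm (X n \<omega> - X (Suc n) \<omega>))) \<noteq> \<infinity>"
    by (intro nn_integral_PInf_AE) auto
  then have "AE \<omega> in \<Omega>. convergent (\<lambda>n. X n \<omega>)"
  proof eventually_elim
    fix \<omega> assume "(\<Sum>n. ennreal (norm (X n \<omega> - X (Suc n) \<omega>))) \<noteq> \<infinity>"
    then have "summable (\<lambda>n. norm (X n \<omega> - X (Suc n) \<omega>))"
      by (intro summable_suminf_not_top) auto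
    then have "summable (\<lambda>n. X n \<omega> - X (Suc n) \<omega>)"
      by (rule summable_norm_cancel)
    then have "(\<lambda>n. \<Sum>i<n. X i \<omega> - X (Suc i) \<omega>) \<longlonglongrightarrow> (\<Sum>n. X n \<omega> - X (Suc n) \<omega>)"
      by (rule summable_LIMSEQ)
    moreover have "(\<Sum>i<n. X i \<omega> - X (Suc i) \<omega>) = X 0 \<omega> - X n \<omega>" for n
      by (rule sum_lessThan_telescope')
    ultimately have "(\<lambda>n. X 0 \<omega> - (X 0 \<omega> - X n \<omega>)) \<longlonglongrightarrow> X 0 \<omega> - (\<Sum>n. X n \<omega> - X (Suc n) \<omega>)"
      by (intro tendsto_diff tendsto_const) (simp only:)
    then show "convergent (\<lambda>n. X n \<omega>)"
      by (auto simp: convergent_def)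
  qed
  \<comment> \<open>\<open>lim\<close> is unspecified where the chain diverges, which happens with
    probability 0.\<close>
  define Y where "Y \<omega> = lim (\<lambda>n. X n \<omega>)" for \<omega>
  have Y [measurable]: "Y \<in> borel_measurable \<Omega>"
    unfolding Y_def by (rule borel_measurable_lim_metric) measurable
  have limY: "AE \<omega> in \<Omega>. (\<lambda>n. X n \<omega>) \<longlonglongrightarrow> Y \<omega>"
    using \<open>AE \<omega> in \<Omega>. convergent (\<lambda>n. X n \<omega>)\<close> by eventually_elim (simp add: Y_def convergent_LIMSEQ_iff)
  have XY: "(\<integral>\<^sup>+ \<omega>. ennreal ((norm (X n \<omega> - Y \<omega>))\<^sup>2) \<partial>\<Omega>) \<le> ennreal ((2 * (1 / 2) ^ n)\<^sup>2)" for n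
  proof -
    have "(\<integral>\<^sup>+ \<omega>. ennreal ((norm (X n \<omega> - Y \<omega>))\<^sup>2) \<partial>\<Omega>)
        = (\<integral>\<^sup>+ \<omega>. liminf (\<lambda>k. ennreal ((norm (X n \<omega> - X (n + k) \<omega>))\<^sup>2)) \<partial>\<Omega>)"
    proof (rule nn_integral_cong_AE, use limY in eventually_elim)
      fix \<omega> assume "(\<lambda>n. X n \<omega>) \<longlonglongrightarrow> Y \<omega>"
      then have "(\<lambda>k. X (n + k) \<omega>) \<longlonglongrightarrow> Y \<omega>"
        by (subst add.commute) (rule LIMSEQ_ignore_initial_segment)
      then have "(\<lambda>k. ennreal ((norm (X n \<omega> - X (n + k) \<omega>))\<^sup>2)) \<longlonglongrightarrow> ennreal ((norm (X n \<omega> - Y \<omega>))\<^sup>2)"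
        by (intro tendsto_ennrealI tendsto_intros)
      then show "ennreal ((norm (X n \<omega> - Y \<omega>))\<^sup>2) = liminf (\<lambda>k. ennreal ((norm (X n \<omega> - X (n + k) \<omega>))\<^sup>2))"
        by (intro lim_imp_Liminf[symmetric]) simp_all
    qed
    also have "\<dots> \<le> liminf (\<lambda>k. \<integral>\<^sup>+ \<omega>. ennreal ((norm (X n \<omega> - X (n + k) \<omega>))\<^sup>2) \<partial>\<Omega>)"
      by (rule nn_integral_liminf) measurable
    also have "\<dots> \<le> liminf (\<lambda>k::nat. ennreal ((2 * (1 / 2) ^ n)\<^sup>2))"
      by (intro Liminf_mono always_eventually allI far)
    also have "\<dots> = ennreal ((2 * (1 / 2) ^ n)\<^sup>2)"
      by (simp add: Liminf_const)
    finally show ?thesis .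
  qed
  show ?thesis
  proof
    \<comment> \<open>The added 1 makes \<open>a\<close> positive, as
      \<open>nn_integral_minkowski_dist\<close> demands.\<close>
    define a where "a = sqrt (second_moment (\<mu> 0)) + 1"
    have "0 < a"
      using second_moment_nonneg[of "\<mu> 0"] by (simp add: a_def add_nonneg_pos)
    have "(\<integral>\<^sup>+ \<omega>. ennreal ((norm (0 - X 0 \<omega>))\<^sup>2) \<partial>\<Omega>) = (\<integral>\<^sup>+ x. ennreal ((norm x)\<^sup>2) \<partial>\<mu> 0)"
      by (subst law[symmetric], subst nn_integral_distr) auto
    also have "\<dots> = ennreal (second_moment (\<mu> 0))"
      unfolding second_moment_def by (rule nn_integral_eq_integral[OF P2D(3)[OF P2]]) simp
    also have "\<dots> \<le> ennreal (a\<^sup>2)"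
    proof (rule ennreal_leI)
      have "(sqrt (second_moment (\<mu> 0)))\<^sup>2 \<le> a\<^sup>2"
        using second_moment_nonneg[of "\<mu> 0"] by (intro power_mono) (auto simp: a_def)
      then show "second_moment (\<mu> 0) \<le> a\<^sup>2"
        using second_moment_nonneg[of "\<mu> 0"] by simp
    qed
    finally have "(\<integral>\<^sup>+ \<omega>. ennreal ((norm (0 - Y \<omega>))\<^sup>2) \<partial>\<Omega>) \<le> ennreal ((a + 2 * (1 / 2) ^ 0)\<^sup>2)"
      using XY[of 0] \<open>0 < a\<close> by (intro nn_integral_minkowski_dist[where Y="X 0" and X="\<lambda>_. 0"]) auto
    also have "\<dots> < \<infinity>"
      by simp
    finally show "distr \<Omega> borel Y \<in> P2"
      by (intro P2I prob_space_distr) (auto simp: nn_integral_distr)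
    show "W2 (\<mu> n) (distr \<Omega> borel Y) \<le> 2 * (1 / 2) ^ n" for n
      by (rule W2_le_of_random_variables[OF \<Omega> X Y law refl XY]) simp
  qed
qed

lemma mcomplete_centered_P2:
  "Metric_space.mcomplete (centered_P2 :: 'a::euclidean_space measure set) W2"
proof -
  interpret Metric_space "centered_P2 :: 'a measure set" W2
    by (rule Metric_space.subspace[OF Metric_space_P2]) (auto simp: centered_P2_def)
  show ?thesis
    unfolding mcomplete_def
  proof (intro allI impI)
    fix \<sigma> :: "nat \<Rightarrow> 'a measure" assume \<sigma>: "MCauchy \<sigma>"
    then have cent: "\<sigma> n \<in> centered_P2" for n
      by (auto simp: MCauchy_def)
    then have P2: "\<sigma> n \<in> P2" for n
      by (rule centered_P2D)
    have "\<forall>k. \<exists>N. \<forall>m n. N \<le> m \<longrightarrow> N \<le> n \<longrightarrow> W2 (\<sigma> m) (\<sigma> n) < (1 / 2) ^ k"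
      using \<sigma> unfolding MCauchy_def by auto
    from choice[OF this] obtain N where N: "\<And>k m n. N k \<le> m \<Longrightarrow> N k \<le> n \<Longrightarrow> W2 (\<sigma> m) (\<sigma> n) < (1 / 2) ^ k"
      by blast
    \<comment> \<open>These partial sums increase strictly and dominate \<open>N k\<close>.\<close>
    define r where "r k = (\<Sum>i\<le>k. Suc (N i))" for k
    have r: "strict_mono r"
      by (simp add: strict_mono_Suc_iff r_def)
    have "N k \<le> r k" for k
      using member_le_sum[of k "{..k}" "\<lambda>i. Suc (N i)"] by (simp add: r_def)
    moreover then have "N k \<le> r (Suc k)" for k
      using r by (meson le_trans lessI less_imp_le strict_mono_less)
    ultimately have "W2 (\<sigma> (r k)) (\<sigma> (r (Suc k))) < (1 / 2) ^ k" for k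
      by (intro N)
    then obtain \<nu> where \<nu>: "\<nu> \<in> P2" "\<And>k. W2 (\<sigma> (r k)) \<nu> \<le> 2 * (1 / 2) ^ k"
      using W2_fast_Cauchy_converges[where \<mu>="\<lambda>k. \<sigma> (r k)", OF P2] by blast
    have null: "(\<lambda>k. 2 * (1 / 2) ^ k :: real) \<longlonglongrightarrow> 0"
      by (intro tendsto_mult_right_zero LIMSEQ_realpow_zero) auto
    have "norm (mean \<nu>) \<le> 2 * (1 / 2) ^ k" for k
      using dist_mean_le_W2[OF P2 \<nu>(1), of "r k"] \<nu>(2)[of k] centered_P2D(2)[OF cent, of "r k"] by simp
    then have "norm (mean \<nu>) \<le> 0"
      by (intro LIMSEQ_le_const[OF null]) auto
    then have "\<nu> \<in> centered_P2"
      using \<nu>(1) by (simp add: centered_P2_def)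
    moreover have "(\<lambda>k. W2 ((\<sigma> \<circ> r) k) \<nu>) \<longlonglongrightarrow> 0"
      by (rule tendsto_sandwich[OF _ _ tendsto_const null]) (use \<nu>(2) W2_nonneg in auto)
    ultimately have "limitin mtopology (\<sigma> \<circ> r) \<nu> sequentially"
      using cent by (auto simp: limitin_metric_dist_null)
    then show "\<exists>\<nu>. limitin mtopology \<sigma> \<nu> sequentially"
      using MCauchy_convergent_subsequence[OF \<sigma> r] by blast
  qed
qed

section \<open>Separability\<close>

definition rational_atomic :: "'a::euclidean_space set \<Rightarrow> 'a measure set" where
  "rational_atomic D = {\<rho>. prob_space \<rho> \<and> sets \<rho> = sets borel \<and>
     (\<exists>A. finite A \<and> A \<subseteq> D \<and> measure \<rho> A = 1 \<and> (\<forall>x\<in>A. measure \<rho> {x} \<in> \<rat>))}"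

text \<open>Such a measure is determined by the finite set of its pairs (atom, weight), a finite
  subset of the countable set \<open>D \<times> \<rat>\<close>. A support is not unique, so one is
  chosen for each measure.\<close>

lemma countable_rational_atomic:
  fixes D :: "'a::euclidean_space set"
  assumes "countable D"
  shows "countable (rational_atomic D)"
proof -
  define A where "A \<rho> = (SOME A. finite A \<and> A \<subseteq> D \<and> measure \<rho> A = 1 \<and> (\<forall>x\<in>A. measure \<rho> {x} \<in> \<rat>))"
    for \<rho> :: "'a measure"
  have A: "finite (A \<rho>) \<and> A \<rho> \<subseteq> D \<and> measure \<rho> (A \<rho>) = 1 \<and> (\<forall>x\<in>A \<rho>. measure \<rho> {x} \<in> \<rat>)"
    if "\<rho> \<in> rational_atomic D" for \<rho>
    unfolding A_def by (rule someI_ex) (use that in \<open>auto simp: rational_atomic_def\<close>)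
  define \<Phi> where "\<Phi> \<rho> = (\<lambda>x. (x, measure \<rho> {x})) ` A \<rho>" for \<rho>
  have meas: "emeasure \<rho> B = ennreal (\<Sum>p\<in>\<Phi> \<rho>. if fst p \<in> B then snd p else 0)"
    if \<rho>: "\<rho> \<in> rational_atomic D" and B: "B \<in> sets borel" for \<rho> B
  proof -
    have sets: "sets \<rho> = sets borel" and "prob_space \<rho>"
      using \<rho> by (auto simp: rational_atomic_def)
    interpret prob_space \<rho> by fact
    have fin: "finite (A \<rho>)" and one: "prob (A \<rho>) = 1"
      using A[OF \<rho>] by auto
    have A_sets: "A \<rho> \<in> events"
      unfolding sets using fin by (simp add: finite_imp_closed borel_closed)
    then have ae: "AE x in \<rho>. x \<in> A \<rho>"
      using one by (simp add: prob_eq_1)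
    have "prob B = prob (B \<inter> A \<rho>)"
      by (rule finite_measure_eq_AE) (use ae A_sets B sets in auto)
    also have "\<dots> = (\<Sum>x\<in>B \<inter> A \<rho>. prob {x})"
      by (rule finite_measure_eq_sum_singleton) (use fin sets in auto)
    also have "\<dots> = (\<Sum>x\<in>A \<rho>. if x \<in> B then prob {x} else 0)"
      using fin by (subst Int_commute) (rule sum.inter_restrict)
    also have "\<dots> = (\<Sum>p\<in>\<Phi> \<rho>. if fst p \<in> B then snd p else 0)"
      unfolding \<Phi>_def by (subst sum.reindex) (auto simp: inj_on_def intro!: sum.cong)
    finally show ?thesis
      by (simp add: emeasure_eq_measure)
  qed
  have "inj_on \<Phi> (rational_atomic D)"
  proof (rule inj_onI, rule measure_eqI)
    fix \<rho> \<rho>' assume \<rho>: "\<rho> \<in> rational_atomic D" "\<rho>' \<in> rational_atomic D" and eq: "\<Phi> \<rho> = \<Phi> \<rho>'"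
    then show "sets \<rho> = sets \<rho>'"
      by (auto simp: rational_atomic_def)
    fix B assume "B \<in> sets \<rho>"
    then have "B \<in> sets borel"
      using \<rho> by (auto simp: rational_atomic_def)
    then show "emeasure \<rho> B = emeasure \<rho>' B"
      using meas[OF \<rho>(1)] meas[OF \<rho>(2)] eq by simp
  qed
  moreover have "\<Phi> ` rational_atomic D \<subseteq> {S. finite S \<and> S \<subseteq> D \<times> \<rat>}"
    using A by (fastforce simp: \<Phi>_def)
  moreover have "countable {S. finite S \<and> S \<subseteq> D \<times> (\<rat> :: real set)}"
    using assms countable_rat by (intro countable_Collect_finite_subset) auto
  ultimately show ?thesis
    by (meson countable_image_inj_on countable_subset)
qed

text \<open>The weights of the law of the simple map \<open>F\<close> are rounded down to multiples of \<open>1/N\<close>, the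
  excess mass being moved to the origin; an independent uniform variable decides what is moved.\<close>

lemma rational_atomic_approx:
  fixes \<mu> :: "'a::euclidean_space measure"
  assumes \<mu>: "\<mu> \<in> P2" and F: "simple_function borel F" "range F \<subseteq> D" "0 \<in> D"
    and dom: "\<And>x. norm (F x) \<le> 2 * norm x"
    and near: "(\<integral>\<^sup>+ x. ennreal ((norm (x - F x))\<^sup>2) \<partial>\<mu>) \<le> ennreal (e\<^sup>2)" and e: "0 < e"
  obtains \<rho> where "\<rho> \<in> rational_atomic D" "\<rho> \<in> P2" "W2 \<mu> \<rho> \<le> e + e"
proof -
  note \<mu>D = P2D[OF \<mu>]
  note [measurable_cong] = \<mu>D(2)
  interpret \<mu>: prob_space \<mu> by (fact \<mu>D)
  have sp: "space \<mu> = UNIV"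
    using sets_eq_imp_space_eq[OF \<mu>D(2)] by simp
  have F_meas [measurable]: "F \<in> borel_measurable borel"
    using borel_measurable_simple_function[OF F(1)] .
  have fin: "finite (range F)"
    using simple_functionD(1)[OF F(1)] by simp
  define p where "p d = measure \<mu> {x. F x = d}" for d
  have p0: "0 \<le> p d" for d
    by (simp add: p_def)
  \<comment> \<open>Rounding moves at most \<open>1 / N\<close> of mass from each \<open>d\<close>
    to 0, at cost \<open>(norm d)\<^sup>2\<close> per unit; \<open>N\<close> makes the total at most
    \<open>e\<^sup>2\<close>.\<close>
  obtain N :: nat where N: "(\<Sum>d\<in>range F. (norm d)\<^sup>2) / e\<^sup>2 < real N"
    using reals_Archimedean2 by blast
  have "0 \<le> (\<Sum>d\<in>range F. (norm d)\<^sup>2) / e\<^sup>2"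
    by (simp add: sum_nonneg)
  then have N0: "0 < N"
    using N by (cases N) auto
  then have N': "(\<Sum>d\<in>range F. (norm d)\<^sup>2) / N \<le> e\<^sup>2"
    using N e by (simp add: field_simps)
  define b where "b d = real_of_int \<lfloor>N * p d\<rfloor> / N" for d
  have b: "0 \<le> b d" "b d \<le> p d" "p d - b d \<le> 1 / N" "b d \<in> \<rat>" for d
  proof -
    show "0 \<le> b d"
      using p0 by (simp add: b_def)
    have "0 \<le> N * p d - real_of_int \<lfloor>N * p d\<rfloor>" "N * p d - real_of_int \<lfloor>N * p d\<rfloor> \<le> 1"
      by linarith+
    then have "0 \<le> (N * p d - real_of_int \<lfloor>N * p d\<rfloor>) / N" "(N * p d - real_of_int \<lfloor>N * p d\<rfloor>) / N \<le> 1 / N"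
      by (simp_all only: divide_right_mono divide_nonneg_nonneg of_nat_0_le_iff)
    moreover have "p d - b d = (N * p d - real_of_int \<lfloor>N * p d\<rfloor>) / N"
      using N0 by (simp add: b_def diff_divide_distrib)
    ultimately show "b d \<le> p d" "p d - b d \<le> 1 / N"
      by linarith+
    show "b d \<in> \<rat>"
      unfolding b_def by simp
  qed
  \<comment> \<open>The fraction of the mass at \<open>d\<close> that stays. If
    \<open>p d = 0\<close>, then \<open>b d = 0\<close> and the quotient is 0 by convention, so
    \<open>p d * \<beta> d = b d\<close> survives.\<close>
  define \<beta> where "\<beta> d = b d / p d" for d
  have \<beta>: "0 \<le> \<beta> d" "\<beta> d \<le> 1" "p d * \<beta> d = b d" for d
    using b(1,2)[of d] p0[of d] by (auto simp: \<beta>_def divide_le_eq_1)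
  define U :: "real measure" where "U = uniform_measure lborel {0..1}"
  have U_prob: "prob_space U"
    unfolding U_def by (rule prob_space_uniform_measure) auto
  interpret U: prob_space U by (fact U_prob)
  have U_sets [measurable_cong]: "sets U = sets borel"
    by (simp add: U_def)
  have U_space: "space U = UNIV"
    using sets_eq_imp_space_eq[OF U_sets] by simp
  have U_le: "measure U {..t} = t" if "0 \<le> t" "t \<le> 1" for t
  proof -
    have "{0..1} \<inter> {..t} = {0..t}"
      using that by auto
    then show ?thesis
      using that by (simp add: U_def)
  qed
  have U_gt: "measure U {t<..} = 1 - t" if "0 \<le> t" "t \<le> 1" for t
  proof -
    have "{t<..} = space U - {..t}"
      by (auto simp: U_space)
    then show ?thesis
      using U.prob_compl[of "{..t}"] U_le[OF that] by (simp add: U_sets)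
  qed
  interpret pair_prob_space \<mu> U ..
  let ?\<Omega> = "\<mu> \<Otimes>\<^sub>M U"
  have \<Omega>: "prob_space ?\<Omega>"
    by (rule prob_space_axioms)
  have \<Omega>_space: "space ?\<Omega> = UNIV"
    by (simp add: space_pair_measure sp U_space)
  have \<beta>F [measurable]: "(\<lambda>x. \<beta> (F x)) \<in> borel_measurable borel"
    by (rule borel_measurable_simple_function[OF simple_function_compose1[OF F(1)]])
  define Y where "Y w = (if snd w \<le> \<beta> (F (fst w)) then F (fst w) else 0)" for w
  have Y [measurable]: "Y \<in> borel_measurable ?\<Omega>"
    unfolding Y_def by measurable
  define \<rho> where "\<rho> = distr ?\<Omega> borel Y"
  have \<rho>_prob: "prob_space \<rho>"
    unfolding \<rho>_def by (rule prob_space_distr) simp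
  interpret \<rho>: prob_space \<rho> by (fact \<rho>_prob)
  have \<rho>_sets: "sets \<rho> = sets borel"
    by (simp add: \<rho>_def)
  have F_sets: "{x. F x = d} \<in> sets \<mu>" for d
    using measurable_sets[OF F_meas, of "{d}"] by (simp add: \<mu>D vimage_def)
  have rect: "measure ?\<Omega> (S \<times> T) = measure \<mu> S * measure U T" if "S \<in> sets \<mu>" "T \<in> sets U" for S T
    using that by (simp add: measure_def U.emeasure_pair_measure_Times enn2real_mult)
  have fst_law: "distr ?\<Omega> borel fst = \<mu>"
    using U.distr_pair_fst[of \<mu>] by (metis \<mu>D(2) distr_cong)
  \<comment> \<open>The origin is excepted because it also collects the moved mass; its weight, the
    complement of the others, is rational as well.\<close>
  have atom: "measure \<rho> {d} = b d" if "d \<noteq> 0" for d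
  proof -
    have "measure \<rho> {d} = measure ?\<Omega> (Y -` {d} \<inter> space ?\<Omega>)"
      unfolding \<rho>_def by (rule measure_distr) auto
    also have "Y -` {d} \<inter> space ?\<Omega> = {x. F x = d} \<times> {..\<beta> d}"
      using that by (auto simp: Y_def \<Omega>_space split: if_splits)
    also have "measure ?\<Omega> \<dots> = p d * \<beta> d"
      using \<beta>[of d] by (subst rect) (auto simp: F_sets U_sets U_le p_def)
    finally show ?thesis
      by (simp add: \<beta>)
  qed
  let ?A = "insert 0 (range F)"
  have A_one: "measure \<rho> ?A = 1"
  proof -
    have "Y -` ?A \<inter> space ?\<Omega> = space ?\<Omega>"
      by (auto simp: Y_def)
    then have "measure \<rho> ?A = prob (space ?\<Omega>)"
      unfolding \<rho>_def using fin by (subst measure_distr) (auto simp: finite_imp_closed borel_closed)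
    then show ?thesis
      by (simp add: prob_space)
  qed
  have zero: "measure \<rho> {0} = 1 - (\<Sum>d\<in>range F - {0}. b d)"
  proof -
    have "measure \<rho> ?A = (\<Sum>d\<in>?A. measure \<rho> {d})"
      by (rule \<rho>.finite_measure_eq_sum_singleton) (use fin \<rho>_sets in auto)
    also have "\<dots> = measure \<rho> {0} + (\<Sum>d\<in>range F - {0}. measure \<rho> {d})"
      using fin by (rule sum.insert_remove)
    also have "(\<Sum>d\<in>range F - {0}. measure \<rho> {d}) = (\<Sum>d\<in>range F - {0}. b d)"
      by (intro sum.cong) (auto simp: atom)
    finally show ?thesis
      using A_one by simp
  qed
  have "measure \<rho> {d} \<in> \<rat>" for d
  proof (cases "d = 0")
    case True
    have "(\<Sum>d\<in>range F - {0}. b d) \<in> \<rat>"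
      by (intro Rats_sum b)
    then show ?thesis
      using True zero by simp
  qed (simp add: atom b)
  then have "\<rho> \<in> rational_atomic D"
    unfolding rational_atomic_def using \<rho>_prob \<rho>_sets fin F(2,3) A_one
    by (auto intro!: exI[of _ ?A])
  moreover have "\<rho> \<in> P2"
  proof (rule P2I[OF \<rho>_prob \<rho>_sets])
    have "(\<integral>\<^sup>+ y. ennreal ((norm y)\<^sup>2) \<partial>\<rho>) = (\<integral>\<^sup>+ w. ennreal ((norm (Y w))\<^sup>2) \<partial>?\<Omega>)"
      unfolding \<rho>_def by (rule nn_integral_distr) auto
    also have "\<dots> \<le> (\<integral>\<^sup>+ w. ennreal (4 * (norm (fst w))\<^sup>2) \<partial>?\<Omega>)"
    proof (intro nn_integral_mono ennreal_leI)
      fix w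
      have "(norm (Y w))\<^sup>2 \<le> (2 * norm (fst w))\<^sup>2"
        using dom[of "fst w"] by (intro power_mono) (auto simp: Y_def)
      then show "(norm (Y w))\<^sup>2 \<le> 4 * (norm (fst w))\<^sup>2"
        by (simp add: power_mult_distrib)
    qed
    also have "\<dots> = (\<integral>\<^sup>+ x. ennreal (4 * (norm x)\<^sup>2) \<partial>\<mu>)"
      by (subst fst_law[symmetric], subst nn_integral_distr) auto
    also have "\<dots> = 4 * (\<integral>\<^sup>+ x. ennreal ((norm x)\<^sup>2) \<partial>\<mu>)"
      by (simp add: ennreal_mult nn_integral_cmult)
    also have "\<dots> < \<infinity>"
      using P2_nn_integral_finite[OF \<mu>] by (simp add: ennreal_mult_less_top)
    finally show "(\<integral>\<^sup>+ y. ennreal ((norm y)\<^sup>2) \<partial>\<rho>) < \<infinity>" .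
  qed
  moreover have "W2 \<mu> \<rho> \<le> e + e"
  proof (rule W2_le_of_random_variables[OF \<Omega>])
    show "fst \<in> borel_measurable ?\<Omega>" "Y \<in> borel_measurable ?\<Omega>"
      by measurable
    show "distr ?\<Omega> borel fst = \<mu>" "distr ?\<Omega> borel Y = \<rho>"
      by (simp_all add: fst_law \<rho>_def)
    show "(\<integral>\<^sup>+ w. ennreal ((norm (fst w - Y w))\<^sup>2) \<partial>?\<Omega>) \<le> ennreal ((e + e)\<^sup>2)"
    proof (rule nn_integral_minkowski_dist[OF _ _ _ _ _ e e])
      show "fst \<in> borel_measurable ?\<Omega>" "Y \<in> borel_measurable ?\<Omega>" "(\<lambda>w. F (fst w)) \<in> borel_measurable ?\<Omega>"
        by measurable
      have "(\<integral>\<^sup>+ w. ennreal ((norm (fst w - F (fst w)))\<^sup>2) \<partial>?\<Omega>) = (\<integral>\<^sup>+ x. ennreal ((norm (x - F x))\<^sup>2) \<partial>\<mu>)"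
        by (subst (2) fst_law[symmetric], subst nn_integral_distr) auto
      then show "(\<integral>\<^sup>+ w. ennreal ((norm (fst w - F (fst w)))\<^sup>2) \<partial>?\<Omega>) \<le> ennreal (e\<^sup>2)"
        using near by simp
      \<comment> \<open>The event that mass is moved from \<open>d\<close> to 0.\<close>
      let ?E = "\<lambda>d. {x. F x = d} \<times> {\<beta> d<..}"
      have E [measurable]: "?E d \<in> sets ?\<Omega>" for d
        by (intro pair_measureI F_sets) (simp add: U_sets)
      have "(\<integral>\<^sup>+ w. ennreal ((norm (F (fst w) - Y w))\<^sup>2) \<partial>?\<Omega>)
          = (\<integral>\<^sup>+ w. (\<Sum>d\<in>range F. ennreal ((norm d)\<^sup>2) * indicator (?E d) w) \<partial>?\<Omega>)"
      proof (rule nn_integral_cong)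
        fix w :: "'a \<times> real"
        have "(\<Sum>d\<in>range F. ennreal ((norm d)\<^sup>2) * indicator (?E d) w)
            = (\<Sum>d\<in>range F. if d = F (fst w) then ennreal ((norm d)\<^sup>2) * indicator {\<beta> d<..} (snd w) else 0)"
          by (intro sum.cong) (auto simp: indicator_def mem_Times_iff)
        also have "\<dots> = ennreal ((norm (F (fst w)))\<^sup>2) * indicator {\<beta> (F (fst w))<..} (snd w)"
          using fin by simp
        also have "\<dots> = ennreal ((norm (F (fst w) - Y w))\<^sup>2)"
          by (auto simp: Y_def indicator_def)
        finally show "ennreal ((norm (F (fst w) - Y w))\<^sup>2)
            = (\<Sum>d\<in>range F. ennreal ((norm d)\<^sup>2) * indicator (?E d) w)" ..
      qed
      also have "\<dots> = (\<Sum>d\<in>range F. ennreal ((norm d)\<^sup>2) * emeasure ?\<Omega> (?E d))"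
        by (subst nn_integral_sum) (auto simp: nn_integral_cmult_indicator)
      also have "\<dots> = (\<Sum>d\<in>range F. ennreal ((norm d)\<^sup>2 * (p d - b d)))"
      proof (rule sum.cong[OF refl])
        fix d
        have "measure ?\<Omega> (?E d) = p d * (1 - \<beta> d)"
          using \<beta>[of d] by (subst rect) (auto simp: F_sets U_sets U_gt p_def)
        also have "\<dots> = p d - b d"
          by (simp add: right_diff_distrib \<beta>)
        finally show "ennreal ((norm d)\<^sup>2) * emeasure ?\<Omega> (?E d) = ennreal ((norm d)\<^sup>2 * (p d - b d))"
          using b(2)[of d] by (simp add: emeasure_eq_measure ennreal_mult)
      qed
      also have "\<dots> = ennreal (\<Sum>d\<in>range F. (norm d)\<^sup>2 * (p d - b d))"
        using b(2) by (intro sum_ennreal) simp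
      also have "\<dots> \<le> ennreal (e\<^sup>2)"
      proof (rule ennreal_leI)
        have "(\<Sum>d\<in>range F. (norm d)\<^sup>2 * (p d - b d)) \<le> (\<Sum>d\<in>range F. (norm d)\<^sup>2 * (1 / N))"
          by (intro sum_mono mult_left_mono b) simp
        also have "\<dots> = (\<Sum>d\<in>range F. (norm d)\<^sup>2) / N"
          by (simp add: sum_divide_distrib)
        finally show "(\<Sum>d\<in>range F. (norm d)\<^sup>2 * (p d - b d)) \<le> e\<^sup>2"
          using N' by simp
      qed
      finally show "(\<integral>\<^sup>+ w. ennreal ((norm (F (fst w) - Y w))\<^sup>2) \<partial>?\<Omega>) \<le> ennreal (e\<^sup>2)" .
    qed
  qed (use e in simp)
  ultimately show ?thesis
    using that by blast
qed

text \<open>The simple maps \<open>F i\<close> approximate the identity and are the same for all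
  measures, so one countable set \<open>D\<close> of atoms serves all of \<open>P2\<close>. Their
  linear growth bound gives \<open>norm (x - F i x) \<le> 3 * norm x\<close>, hence the dominating
  function \<open>9 * (norm x)\<^sup>2\<close>.\<close>

lemma ex_countable_dense_P2:
  obtains C :: "'a::euclidean_space measure set" where "countable C" "C \<subseteq> P2"
    "\<And>\<mu> e. \<mu> \<in> P2 \<Longrightarrow> 0 < e \<Longrightarrow> \<exists>\<rho>\<in>C. W2 \<mu> \<rho> < e"
proof -
  obtain F :: "nat \<Rightarrow> 'a \<Rightarrow> 'a" where F: "\<And>i. simple_function borel (F i)"
    and lim: "\<And>x. (\<lambda>i. F i x) \<longlonglongrightarrow> x" and dom: "\<And>i x. dist (F i x) 0 \<le> 2 * dist x 0"
    using borel_measurable_implies_sequence_metric[of "\<lambda>x :: 'a. x" borel 0] by auto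
  define D where "D = insert 0 (\<Union>i. range (F i))"
  have "countable (range (F i))" for i
    using simple_functionD(1)[OF F, of i] by (intro countable_finite) simp
  then have "countable D"
    by (simp add: D_def)
  define C where "C = rational_atomic D \<inter> P2"
  show ?thesis
  proof
    show "countable C" "C \<subseteq> P2"
      using countable_rational_atomic[OF \<open>countable D\<close>] by (auto simp: C_def)
    fix \<mu> :: "'a measure" and e :: real assume \<mu>: "\<mu> \<in> P2" and e: "0 < e"
    note [measurable_cong] = P2D(2)[OF \<mu>]
    have F_meas [measurable]: "F i \<in> borel_measurable borel" for i
      by (rule borel_measurable_simple_function[OF F])
    have le9: "(norm (x - F i x))\<^sup>2 \<le> 9 * (norm x)\<^sup>2" for i x
    proof -
      have "norm (x - F i x) \<le> 3 * norm x"
        using norm_triangle_ineq4[of x "F i x"] dom[of i x] by simp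
      then have "(norm (x - F i x))\<^sup>2 \<le> (3 * norm x)\<^sup>2"
        by (intro power_mono) auto
      then show ?thesis
        by (simp add: power_mult_distrib)
    qed
    have int: "integrable \<mu> (\<lambda>x. (norm (x - F i x))\<^sup>2)" for i
    proof (rule Bochner_Integration.integrable_bound)
      show "integrable \<mu> (\<lambda>x. 9 * (norm x)\<^sup>2)"
        using P2D(3)[OF \<mu>] by simp
    qed (use le9 in auto)
    have "(\<lambda>i. \<integral>x. (norm (x - F i x))\<^sup>2 \<partial>\<mu>) \<longlonglongrightarrow> (\<integral>x. 0 \<partial>\<mu>)"
    proof (rule integral_dominated_convergence)
      show "integrable \<mu> (\<lambda>x. 9 * (norm x)\<^sup>2)"
        using P2D(3)[OF \<mu>] by simp
      show "AE x in \<mu>. (\<lambda>i. (norm (x - F i x))\<^sup>2) \<longlonglongrightarrow> 0"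
      proof (rule AE_I2)
        fix x
        have "(\<lambda>i. (norm (x - F i x))\<^sup>2) \<longlonglongrightarrow> (norm (x - x))\<^sup>2"
          by (intro tendsto_intros lim)
        then show "(\<lambda>i. (norm (x - F i x))\<^sup>2) \<longlonglongrightarrow> 0"
          by simp
      qed
      show "AE x in \<mu>. norm ((norm (x - F i x))\<^sup>2) \<le> 9 * (norm x)\<^sup>2" for i
        using le9 by simp
    qed measurable
    then have "(\<lambda>i. \<integral>x. (norm (x - F i x))\<^sup>2 \<partial>\<mu>) \<longlonglongrightarrow> 0"
      by simp
    then have "\<forall>\<^sub>F i in sequentially. (\<integral>x. (norm (x - F i x))\<^sup>2 \<partial>\<mu>) < (e / 4)\<^sup>2"
      using e by (intro order_tendstoD(2)) auto
    then obtain i where i: "(\<integral>x. (norm (x - F i x))\<^sup>2 \<partial>\<mu>) < (e / 4)\<^sup>2"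
      by (auto simp: eventually_sequentially)
    have "(\<integral>\<^sup>+ x. ennreal ((norm (x - F i x))\<^sup>2) \<partial>\<mu>) = ennreal (\<integral>x. (norm (x - F i x))\<^sup>2 \<partial>\<mu>)"
      by (rule nn_integral_eq_integral[OF int]) simp
    also have "\<dots> \<le> ennreal ((e / 4)\<^sup>2)"
      using i by (intro ennreal_leI) simp
    finally have near: "(\<integral>\<^sup>+ x. ennreal ((norm (x - F i x))\<^sup>2) \<partial>\<mu>) \<le> ennreal ((e / 4)\<^sup>2)" .
    \<comment> \<open>Passing to \<open>F i\<close> and rounding cost \<open>e / 4\<close> each,
      which leaves the bound strict.\<close>
    obtain \<rho> where "\<rho> \<in> rational_atomic D" "\<rho> \<in> P2" "W2 \<mu> \<rho> \<le> e / 4 + e / 4"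
    proof (rule rational_atomic_approx[OF \<mu> F[of i] _ _ _ near])
      show "range (F i) \<subseteq> D" "0 \<in> D"
        by (auto simp: D_def)
      show "norm (F i x) \<le> 2 * norm x" for x
        using dom[of i x] by simp
      show "0 < e / 4"
        using e by simp
    qed
    then show "\<exists>\<rho>\<in>C. W2 \<mu> \<rho> < e"
      using e by (intro bexI[of _ \<rho>]) (auto simp: C_def)
  qed
qed

text \<open>A dense set of \<open>P2\<close> need not contain any centered measure, but centering is
  1-Lipschitz and fixes centered measures, so the centered copies are dense among them.\<close>

lemma separable_centered_P2:
  "separable_space (Metric_space.mtopology (centered_P2 :: 'a::euclidean_space measure set) W2)"
proof -
  interpret Metric_space "centered_P2 :: 'a measure set" W2
    by (rule Metric_space.subspace[OF Metric_space_P2]) (auto simp: centered_P2_def)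
  obtain C :: "'a measure set" where C: "countable C" "C \<subseteq> P2"
    and dense: "\<And>\<mu> e. \<mu> \<in> P2 \<Longrightarrow> 0 < e \<Longrightarrow> \<exists>\<rho>\<in>C. W2 \<mu> \<rho> < e"
    using ex_countable_dense_P2 by blast
  define T where "T = (\<lambda>\<mu> :: 'a measure. translate (- mean \<mu>) \<mu>)"
  have T: "T ` C \<subseteq> centered_P2"
    using C center_centered_P2 by (auto simp: T_def)
  have "\<exists>\<rho>\<in>T ` C. \<rho> \<in> mball \<mu> e" if \<mu>: "\<mu> \<in> centered_P2" and "0 < e" for \<mu> e
  proof -
    note P2 = centered_P2D[OF \<mu>]
    obtain \<rho> where \<rho>: "\<rho> \<in> C" "W2 \<mu> \<rho> < e"
      using dense[OF P2(1) \<open>0 < e\<close>] by blast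
    have "T \<mu> = \<mu>"
      using P2 by (simp add: T_def translate_0)
    moreover have "W2 (T \<mu>) (T \<rho>) \<le> W2 \<mu> \<rho>"
      unfolding T_def using P2 \<rho> C by (intro W2_center_le) auto
    ultimately have "T \<rho> \<in> mball \<mu> e"
      using \<rho> T \<mu> by auto
    then show ?thesis
      using \<rho> by blast
  qed
  then have "mtopology closure_of (T ` C) = centered_P2"
    by (auto simp: metric_closure_of)
  then show ?thesis
    unfolding separable_space_def using C T by (intro exI[of _ "T ` C"]) simp
qed

lemma polish_centered_P2: "polish_metric_space (centered_P2 :: 'a::euclidean_space measure set) W2"
  unfolding polish_metric_space_def
  using Metric_space.subspace[OF Metric_space_P2, of centered_P2] mcomplete_centered_P2 separable_centered_P2
  by (auto simp: centered_P2_def)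

theorem corollary1p5:
  shows "has_cone_structure (P2 :: (real ^ 'n) measure set) W2 \<and>
    (\<exists>(Y :: (real ^ 'n) measure set) dY.
       polish_metric_space Y dY \<and> metric_rank Y dY = 0 \<and>
       isometric (P2 :: (real ^ 'n) measure set) W2
         ((UNIV :: (real ^ 'n) set) \<times> Y) (prod_dist dist dY))"
  using has_cone_structure_P2 polish_centered_P2 metric_rank_centered_P2 isometric_P2_product
  by blast

end
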